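(* Let $R$ be a complete discrete valuation ring of equal characteristic with maximal ideal $\mathfrak{p}$ and finite residue field $k=R/\mathfrak{p}$ with $|k|>9$, and let $n\ge2$. Let $H$ be a closed subgroup of $\mathrm{GL}_n(R)$ such that $\mathrm{SL}_n(k)\subset H^{[0]}$ and $H^{[1]}$ contains a non-scalar matrix. Then $H^{\mathrm{der}}=\mathrm{SL}_n(R)$.
   Context: $H^{\mathrm{der}}$ denotes the closure (for the topology induced by $R$) of the derived group of $H$. For $i\ge0$, $H^i=\{h\in H:h\equiv\mathrm{Id}_n\bmod\mathfrak{p}^i\}$ and $H^{[i]}=H^i/H^{i+1}$; $H^{[0]}$ is identified with the image of $H$ in $\mathrm{GL}_n(k)$, and for $i>0$, $H^{[i]}$ is identified with a subgroup of $\mathfrak{gl}_n(\mathfrak{p}^i/\mathfrak{p}^{i+1})$ via $[\mathrm{Id}_n+X]\mapsto[X]$. *)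

theory Defs
  imports "HOL-Analysis.Analysis"
begin

definition is_uniformizer :: "'a::idom \<Rightarrow> bool" where
  "is_uniformizer \<pi> \<longleftrightarrow> \<pi> \<noteq> 0 \<and> \<not> \<pi> dvd 1 \<and>
     (\<forall>x. x \<noteq> 0 \<longrightarrow> (\<exists>u m. u dvd 1 \<and> x = u * \<pi> ^ m))"

definition dvr_with_uniformizer :: "'a::idom \<Rightarrow> bool" where
  "dvr_with_uniformizer \<pi> \<longleftrightarrow> is_uniformizer \<pi>"

definition adic_complete :: "'a::idom \<Rightarrow> bool" where
  "adic_complete \<pi> \<longleftrightarrow>
     (\<forall>x::nat \<Rightarrow> 'a. (\<forall>m. \<pi> ^ m dvd (x (Suc m) - x m)) \<longrightarrow>
        (\<exists>y. \<forall>m. \<pi> ^ m dvd (y - x m)))"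

definition residue_field :: "'a::idom \<Rightarrow> 'a set set" where
  "residue_field \<pi> = UNIV // {(x, y). \<pi> dvd (x - y)}"

definition equal_char :: "'a::idom \<Rightarrow> bool" where
  "equal_char \<pi> \<longleftrightarrow> (\<forall>m::nat. (of_nat m = (0::'a)) \<longleftrightarrow> \<pi> dvd of_nat m)"

definition mat_cong :: "'a::idom \<Rightarrow> nat \<Rightarrow> 'a^'n^'n \<Rightarrow> 'a^'n^'n \<Rightarrow> bool" where
  "mat_cong \<pi> i A B \<longleftrightarrow> (\<forall>r s. \<pi> ^ i dvd (A $ r $ s - B $ r $ s))"

definition GL :: "('a::idom^'n^'n) set" where
  "GL = {A. det A dvd 1}"

definition SL :: "('a::idom^'n^'n) set" where
  "SL = {A. det A = 1}"

definition is_mat_inverse :: "'a::idom^'n^'n \<Rightarrow> 'a^'n^'n \<Rightarrow> bool" where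
  "is_mat_inverse A B \<longleftrightarrow> A ** B = mat 1 \<and> B ** A = mat 1"

definition is_subgroup_GL :: "('a::idom^'n^'n) set \<Rightarrow> bool" where
  "is_subgroup_GL H \<longleftrightarrow> H \<subseteq> GL \<and> mat 1 \<in> H \<and> (\<forall>a\<in>H. \<forall>b\<in>H. a ** b \<in> H) \<and>
     (\<forall>a\<in>H. \<exists>b\<in>H. is_mat_inverse a b)"

definition adic_closure :: "'a::idom \<Rightarrow> ('a^'n^'n) set \<Rightarrow> ('a^'n^'n) set" where
  "adic_closure \<pi> S = {A. \<forall>m. \<exists>h\<in>S. mat_cong \<pi> m A h}"

definition adic_closed :: "'a::idom \<Rightarrow> ('a^'n^'n) set \<Rightarrow> bool" where
  "adic_closed \<pi> S \<longleftrightarrow> adic_closure \<pi> S \<subseteq> S"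

inductive_set gen_subgroup :: "('a::idom^'n^'n) set \<Rightarrow> ('a^'n^'n) set" for S where
  one: "mat 1 \<in> gen_subgroup S"
| gen: "s \<in> S \<Longrightarrow> s \<in> gen_subgroup S"
| mult: "a \<in> gen_subgroup S \<Longrightarrow> b \<in> gen_subgroup S \<Longrightarrow> a ** b \<in> gen_subgroup S"
| inv: "a \<in> gen_subgroup S \<Longrightarrow> is_mat_inverse a b \<Longrightarrow> b \<in> gen_subgroup S"

definition commutators :: "('a::idom^'n^'n) set \<Rightarrow> ('a^'n^'n) set" where
  "commutators H = {a ** b ** a' ** b' | a b a' b'.
      a \<in> H \<and> b \<in> H \<and> is_mat_inverse a a' \<and> is_mat_inverse b b'}"

definition derived_subgroup :: "('a::idom^'n^'n) set \<Rightarrow> ('a^'n^'n) set" where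
  "derived_subgroup H = gen_subgroup (commutators H)"

definition Hder :: "'a::idom \<Rightarrow> ('a^'n^'n) set \<Rightarrow> ('a^'n^'n) set" where
  "Hder \<pi> H = adic_closure \<pi> (derived_subgroup H)"

text \<open>SL_n(k) is contained in H^[0], the image of H in GL_n(k): every matrix over R
  whose reduction lies in SL_n(k) is congruent mod p to an element of H.\<close>
definition SLk_in_H0 :: "'a::idom \<Rightarrow> ('a^'n^'n) set \<Rightarrow> bool" where
  "SLk_in_H0 \<pi> H \<longleftrightarrow> (\<forall>A. \<pi> dvd (det A - 1) \<longrightarrow> (\<exists>h\<in>H. mat_cong \<pi> 1 h A))"

text \<open>H^[1] = H^1/H^2 inside gl_n(p/p^2) via [Id+X] |-> [X] contains a non-scalar matrix.\<close>
definition H1_has_nonscalar :: "'a::idom \<Rightarrow> ('a^'n^'n) set \<Rightarrow> bool" where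
  "H1_has_nonscalar \<pi> H \<longleftrightarrow> (\<exists>h\<in>H. mat_cong \<pi> 1 h (mat 1) \<and>
      \<not> (\<exists>c. mat_cong \<pi> 2 (h - mat 1) (mat c)))"

end

theory Submission
  imports Defs
begin

text \<open>Let \<open>D\<close> be the derived group of \<open>H\<close> and let \<open>level k\<close> consist of all \<open>X\<close> such that \<open>D\<close> contains
  an element congruent to \<open>1 + \<pi>\<^sup>kX\<close> modulo \<open>\<pi>\<close> to the power \<open>k + 1\<close>. It suffices that \<open>D\<close> meets every
  class of \<open>SL\<^sub>n(R)\<close> modulo every power of \<open>\<pi>\<close>. Modulo \<open>\<pi>\<close> this holds because a transvection is the
  commutator of a transvection and a diagonal matrix, and transvections generate \<open>SL\<^sub>n\<close>. The
  passage from \<open>\<pi>\<^sup>k\<close> to the next power amounts to \<open>level k\<close> containing all matrices of trace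
  zero. It is an additive group of residual matrices that is stable under conjugation, so for a
  large residue field one needs only a non-scalar matrix in it, or just a non-scalar \<open>Y\<close> all of
  whose differences \<open>u Y u\<inverse> - Y\<close> for transvections \<open>u\<close> lie in it. For \<open>k = 1\<close> the non-scalar
  element of the first layer of \<open>H\<close> provides such a \<open>Y\<close>; for \<open>k \<ge> 2\<close> a commutator of elements approximated from lower levels
  does, with a separate choice for \<open>2 \<times> 2\<close> matrices in characteristic two, where the Lie algebra
  of trace zero matrices is not perfect.\<close>

section \<open>Matrices over a commutative ring\<close>

definition smat :: "'a::comm_ring_1 \<Rightarrow> 'a^'n^'m \<Rightarrow> 'a^'n^'m" where
  "smat c A = (\<chi> i j. c * A $ i $ j)"

definition single :: "'n \<Rightarrow> 'n \<Rightarrow> 'a::comm_ring_1 \<Rightarrow> 'a^'n^'n" where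
  "single r s a = (\<chi> i j. if i = r \<and> j = s then a else 0)"

abbreviation transvection :: "'n::finite \<Rightarrow> 'n \<Rightarrow> 'a::comm_ring_1 \<Rightarrow> 'a^'n^'n" where
  "transvection r s a \<equiv> mat 1 + single r s a"

lemma smat_nth [simp]: "smat c A $ i $ j = c * A $ i $ j"
  by (simp add: smat_def)

lemma single_nth [simp]: "single r s a $ i $ j = (if i = r \<and> j = s then a else 0)"
  by (simp add: single_def)

lemma mat_nth: "mat c $ i $ j = (if i = j then c else 0)"
  by (simp add: mat_def)

lemma matrix_mul_smat_left [simp]: "smat c A ** B = smat c (A ** B)"
  by (simp add: vec_eq_iff matrix_matrix_mult_def sum_distrib_left mult.assoc)

lemma matrix_mul_smat_right [simp]: "A ** smat c B = smat c (A ** B)"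
  by (simp add: vec_eq_iff matrix_matrix_mult_def sum_distrib_left mult.left_commute)

lemma smat_smat [simp]: "smat c (smat d A) = smat (c * d) A"
  by (simp add: vec_eq_iff mult.assoc)

lemma smat_one [simp]: "smat 1 A = A"
  by (simp add: vec_eq_iff)

lemma matrix_mul_add_right: "(A + B) ** C = A ** C + B ** (C :: 'a::comm_ring_1^'n^'m)"
  by (simp add: vec_eq_iff matrix_matrix_mult_def distrib_right sum.distrib)

lemma matrix_mul_diff_left: "A ** (B - C) = A ** B - A ** (C :: 'a::comm_ring_1^'n^'m)"
  by (simp add: vec_eq_iff matrix_matrix_mult_def right_diff_distrib sum_subtractf)

lemma matrix_mul_diff_right: "(A - B) ** C = A ** C - B ** (C :: 'a::comm_ring_1^'n^'m)"
  by (simp add: vec_eq_iff matrix_matrix_mult_def left_diff_distrib sum_subtractf)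

lemma smat_add: "smat c (A + B) = smat c A + smat c B"
  by (simp add: vec_eq_iff distrib_left)

lemma smat_diff: "smat c (A - B) = smat c A - smat c B"
  by (simp add: vec_eq_iff right_diff_distrib)

lemmas matrix_ring_simps = matrix_mul_add_right matrix_add_ldistrib matrix_mul_diff_left
  matrix_mul_diff_right smat_add smat_diff matrix_mul_assoc[symmetric]

lemma single_mult_nth:
  "(single r s a ** X) $ i $ j = (if i = r then a * X $ s $ j else 0)"
  by (simp add: matrix_matrix_mult_def if_distrib[of "\<lambda>x. x * _"] sum.If_cases
      cong: if_cong)

lemma mult_single_nth:
  "(X ** single r s a) $ i $ j = (if j = s then a * X $ i $ r else 0)"
  by (simp add: matrix_matrix_mult_def if_distrib[of "\<lambda>x. _ * x"] sum.If_cases mult.commute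
      cong: if_cong)

lemma transvection_mult_nth:
  "(transvection r s a ** X) $ i $ j = X $ i $ j + (if i = r then a * X $ s $ j else 0)"
  by (simp add: matrix_mul_add_right single_mult_nth)

lemma mult_transvection_nth:
  "(X ** transvection r s a) $ i $ j = X $ i $ j + (if j = s then a * X $ i $ r else 0)"
  by (simp add: matrix_add_ldistrib mult_single_nth)

lemma transvection_inverse:
  assumes "r \<noteq> s"
  shows "transvection r s a ** transvection r s (- a) = mat 1"
  using assms by (auto simp add: vec_eq_iff transvection_mult_nth mat_nth)

lemma det_transvection:
  assumes "r \<noteq> s"
  shows "det (transvection r s a :: 'a::comm_ring_1^'n^'n) = 1"
proof -
  have "(\<chi> k. if k = r then row r (mat 1) + a *s row s (mat 1) else row k (mat 1)) =
      (transvection r s a :: 'a^'n^'n)"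
    by (auto simp: vec_eq_iff row_def mat_nth)
  then show ?thesis
    using det_row_operation[OF assms, of "mat 1 :: 'a^'n^'n" a] by simp
qed

section \<open>First-order expansion of the determinant near the identity\<close>

lemma prod_one_add_cong:
  fixes c :: "'a::comm_ring_1"
  assumes "finite A"
  shows "c\<^sup>2 dvd (\<Prod>i\<in>A. 1 + c * f i) - 1 - c * (\<Sum>i\<in>A. f i)"
  using assms
proof (induction A)
  case (insert x A)
  let ?P = "\<Prod>i\<in>A. 1 + c * f i" and ?S = "\<Sum>i\<in>A. f i"
  obtain d where d: "?P - 1 - c * ?S = c\<^sup>2 * d" using insert.IH by (auto simp: dvd_def)
  then have P: "?P = 1 + c * ?S + c\<^sup>2 * d" by (simp add: algebra_simps)
  have "(\<Prod>i\<in>insert x A. 1 + c * f i) - 1 - c * (\<Sum>i\<in>insert x A. f i)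
      = c\<^sup>2 * (d + f x * ?S + c * f x * d)"
    using insert.hyps by (simp add: P algebra_simps power2_eq_square)
  then show ?case by simp
qed simp

text \<open>A permutation other than the identity moves some \<open>i\<close> and, by injectivity,
  also \<open>p i\<close>. Its term thus has two off-diagonal factors divisible by \<open>c\<close>,
  and modulo \<open>c\<^sup>2\<close> only the diagonal product remains.\<close>

lemma det_one_add_cong:
  fixes X :: "'a::comm_ring_1^'n^'n"
  shows "c\<^sup>2 dvd det (mat 1 + smat c X) - 1 - c * (\<Sum>i\<in>UNIV. X $ i $ i)"
proof -
  let ?A = "mat 1 + smat c X"
  let ?t = "\<lambda>p. of_int (sign p) * (\<Prod>i\<in>UNIV. ?A $ i $ p i)"
  let ?P = "{p. p permutes (UNIV :: 'n set)}"
  have "c\<^sup>2 dvd ?t p" if p: "p permutes UNIV" "p \<noteq> id" for p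
  proof -
    obtain i where i: "p i \<noteq> i" using p(2) by (metis eq_id_iff)
    have j: "p (p i) \<noteq> p i" using i p(1) by (metis permutes_inj injD)
    have "(\<Prod>i\<in>UNIV. ?A $ i $ p i) =
        ?A $ i $ p i * (?A $ p i $ p (p i) * (\<Prod>l\<in>UNIV - {i} - {p i}. ?A $ l $ p l))"
      using i by (subst prod.remove[of _ i], simp, simp, subst prod.remove[of _ "p i"]) auto
    also have "\<dots> = c\<^sup>2 * (X $ i $ p i * X $ p i $ p (p i) *
        (\<Prod>l\<in>UNIV - {i} - {p i}. ?A $ l $ p l))"
      using i j by (simp add: mat_nth power2_eq_square algebra_simps)
    finally have "c\<^sup>2 dvd (\<Prod>i\<in>UNIV. ?A $ i $ p i)" by (rule dvdI)
    then show ?thesis by (rule dvd_mult)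
  qed
  then have "c\<^sup>2 dvd sum ?t (?P - {id})"
    by (intro dvd_sum) auto
  moreover have "c\<^sup>2 dvd ?t id - 1 - c * (\<Sum>i\<in>UNIV. X $ i $ i)"
    using prod_one_add_cong[of "UNIV :: 'n set" c "\<lambda>i. X $ i $ i"] by (simp add: mat_nth)
  moreover have "det ?A = ?t id + sum ?t (?P - {id})"
    unfolding det_def by (rule sum.remove) (auto simp: permutes_id)
  moreover have "?t id + S - 1 - d = (?t id - 1 - d) + S" for S d :: 'a
    by (simp add: algebra_simps)
  ultimately show ?thesis
    by (simp only: dvd_add)
qed

lemma dvd_det_if_dvd_row:
  fixes A :: "'a::comm_ring_1^'n^'n"
  assumes "\<And>j. c dvd A $ r $ j"
  shows "c dvd det A"
proof -
  have "c dvd (\<Prod>i\<in>UNIV. A $ i $ p i)" for p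
    using assms by (subst prod.remove[of _ r]) simp_all
  then show ?thesis
    unfolding det_def by (intro dvd_sum dvd_mult) simp
qed

section \<open>Congruences of matrices\<close>

lemma mat_cong_iff: "mat_cong \<pi> m A B \<longleftrightarrow> (\<exists>W. A = B + smat (\<pi> ^ m) W)"
proof
  assume "mat_cong \<pi> m A B"
  then have "\<forall>i j. \<exists>w. A $ i $ j - B $ i $ j = \<pi> ^ m * w"
    by (simp add: mat_cong_def dvd_def)
  then obtain w where "A $ i $ j - B $ i $ j = \<pi> ^ m * w i j" for i j by metis
  then have "A $ i $ j = B $ i $ j + \<pi> ^ m * w i j" for i j
    by (simp only: diff_eq_eq add.commute)
  then have "A = B + smat (\<pi> ^ m) (\<chi> i j. w i j)"
    by (simp add: vec_eq_iff)
  then show "\<exists>W. A = B + smat (\<pi> ^ m) W" ..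
qed (auto simp: mat_cong_def)

lemma mat_cong_refl [simp]: "mat_cong \<pi> m A A"
  by (simp add: mat_cong_def)

lemma mat_cong_sym: "mat_cong \<pi> m A B \<Longrightarrow> mat_cong \<pi> m B A"
  unfolding mat_cong_def by (metis dvd_minus_iff minus_diff_eq)

lemma mat_cong_trans: "mat_cong \<pi> m A B \<Longrightarrow> mat_cong \<pi> m B C \<Longrightarrow> mat_cong \<pi> m A C"
  unfolding mat_cong_def
  by (metis (no_types, opaque_lifting) add_diff_eq diff_add_cancel dvd_add)

lemma mat_cong_mono: "mat_cong \<pi> m A B \<Longrightarrow> k \<le> m \<Longrightarrow> mat_cong \<pi> k A B"
  unfolding mat_cong_def by (meson dvd_trans le_imp_power_dvd)

lemma mat_cong_mult:
  assumes "mat_cong \<pi> m A B" "mat_cong \<pi> m C D"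
  shows "mat_cong \<pi> m (A ** C) (B ** D)"
proof -
  obtain V W where "A = B + smat (\<pi> ^ m) V" "C = D + smat (\<pi> ^ m) W"
    using assms by (auto simp: mat_cong_iff)
  then have "A ** C = B ** D + smat (\<pi> ^ m) (V ** D + B ** W + smat (\<pi> ^ m) (V ** W))"
    by (simp add: matrix_ring_simps add_ac)
  then show ?thesis unfolding mat_cong_iff by blast
qed

text \<open>\<open>A' = A' ** B ** B'\<close> is congruent to
  \<open>A' ** A ** B' = B'\<close>.\<close>

lemma mat_cong_inverse:
  assumes "mat_cong \<pi> m A B" "A' ** A = mat 1" "B ** B' = mat 1"
  shows "mat_cong \<pi> m A' B'"
proof -
  have "mat_cong \<pi> m (A' ** (B ** B')) (A' ** (A ** B'))"
    by (intro mat_cong_mult) (simp_all add: assms(1) mat_cong_sym)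
  then show ?thesis
    using assms(2,3) by (metis matrix_mul_assoc matrix_mul_lid matrix_mul_rid)
qed

lemma mat_cong_smat:
  "mat_cong \<pi> m A B \<Longrightarrow> mat_cong \<pi> (k + m) (smat (\<pi> ^ k) A) (smat (\<pi> ^ k) B)"
  by (auto simp: mat_cong_iff smat_add power_add)

lemma mat_cong_add:
  "mat_cong \<pi> m A B \<Longrightarrow> mat_cong \<pi> m C D \<Longrightarrow> mat_cong \<pi> m (A + C) (B + D)"
  by (auto simp: mat_cong_def add_diff_add intro!: dvd_add)

lemma mat_cong_det:
  assumes "mat_cong \<pi> m A B" shows "\<pi> ^ m dvd det A - det B"
proof -
  have c: "\<pi> ^ m dvd (\<Prod>i\<in>S. A $ i $ p i) - (\<Prod>i\<in>S. B $ i $ p i)" if "finite S" for S p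
    using that
  proof induction
    case (insert x S)
    \<comment> \<open>Telescoping: the factors of \<open>A\<close> are exchanged for those of
      \<open>B\<close> one at a time.\<close>
    have "(\<Prod>i\<in>insert x S. A $ i $ p i) - (\<Prod>i\<in>insert x S. B $ i $ p i) =
        A $ x $ p x * ((\<Prod>i\<in>S. A $ i $ p i) - (\<Prod>i\<in>S. B $ i $ p i)) +
        (A $ x $ p x - B $ x $ p x) * (\<Prod>i\<in>S. B $ i $ p i)"
      using insert.hyps by (simp add: algebra_simps)
    then show ?case using assms insert.IH by (simp add: mat_cong_def)
  qed simp
  show ?thesis
    unfolding det_def sum_subtractf[symmetric] right_diff_distrib[symmetric]
    by (intro dvd_sum dvd_mult c) simp
qed

section \<open>Discrete valuation rings with large finite residue field\<close>

locale large_residue_dvr =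
  fixes \<pi> :: "'a::idom"
  assumes uniformizer: "is_uniformizer \<pi>"
    and finite_residue_field: "finite (residue_field \<pi>)"
    and card_residue_field: "card (residue_field \<pi>) > 9"
begin

lemma not_dvd_one: "\<not> \<pi> dvd 1"
  using uniformizer by (simp add: is_uniformizer_def)

lemma unit_if_not_dvd:
  assumes "\<not> \<pi> dvd x" obtains y where "x * y = 1"
proof -
  obtain u m where u: "u dvd 1" and x: "x = u * \<pi> ^ m"
    using uniformizer assms by (metis is_uniformizer_def dvd_0_right)
  have "m = 0" using assms x by (cases m) auto
  then show thesis using u x that by (auto simp: dvd_def)
qed

lemma dvd_mult_iff: "\<pi> dvd x * y \<longleftrightarrow> \<pi> dvd x \<or> \<pi> dvd y"
proof
  assume xy: "\<pi> dvd x * y"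
  show "\<pi> dvd x \<or> \<pi> dvd y"
  proof (rule ccontr)
    assume "\<not> ?thesis"
    then obtain x' y' where "x * x' = 1" "y * y' = 1" by (metis unit_if_not_dvd)
    then have "x * y * (x' * y') = 1" by (metis mult.assoc mult.left_commute mult_1_right)
    then show False using xy not_dvd_one by (metis dvd_mult2)
  qed
qed auto

text \<open>Separatedness of the topology: it will turn a determinant that is 1 modulo every power
  into one equal to 1.\<close>

lemma eq_0_if_dvd_powers:
  assumes "\<And>m. \<pi> ^ m dvd x" shows "x = 0"
proof (rule ccontr)
  assume "x \<noteq> 0"
  then obtain u m where u: "u dvd 1" and x: "x = u * \<pi> ^ m"
    using uniformizer by (metis is_uniformizer_def)
  have "\<pi> ^ m * \<pi> dvd \<pi> ^ m * u" using assms[of "Suc m"] x by (simp add: mult.commute)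
  then have "\<pi> dvd u" using uniformizer by (simp add: is_uniformizer_def)
  then show False using u not_dvd_one dvd_trans by blast
qed

section \<open>Residue classes and the size of the residue field\<close>

definition residue_class :: "'a \<Rightarrow> 'a set" where
  "residue_class x = {y. \<pi> dvd x - y}"

lemma residue_field_eq: "residue_field \<pi> = range residue_class"
  by (auto simp: residue_field_def residue_class_def quotient_def Image_def)

lemma residue_class_eq_iff: "residue_class x = residue_class y \<longleftrightarrow> \<pi> dvd x - y"
proof
  assume eq: "residue_class x = residue_class y"
  have "y \<in> residue_class y" by (simp add: residue_class_def)
  then show "\<pi> dvd x - y" unfolding eq[symmetric] by (simp add: residue_class_def)
next
  assume xy: "\<pi> dvd x - y"
  have "\<pi> dvd x - z \<longleftrightarrow> \<pi> dvd y - z" for z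
    using dvd_add_right_iff[OF xy, of "y - z"] by simp
  then show "residue_class x = residue_class y" by (simp add: residue_class_def)
qed

text \<open>This is where the size of the residue field enters: nine elements cannot represent every
  class.\<close>

lemma avoid_residues:
  assumes "finite F" "card F \<le> 9"
  obtains a where "\<And>f. f \<in> F \<Longrightarrow> \<not> \<pi> dvd a - f"
proof (rule ccontr)
  assume "\<not> thesis"
  then have "\<exists>f\<in>F. residue_class a = residue_class f" for a
    using that by (auto simp: residue_class_eq_iff)
  then have "residue_field \<pi> \<subseteq> residue_class ` F"
    by (auto simp: residue_field_eq)
  then have "card (residue_field \<pi>) \<le> card F"
    using assms(1) by (meson card_image_le card_mono finite_imageI le_trans)
  then show False using assms(2) card_residue_field by simp
qed

text \<open>In residue characteristic two, \<open>x\<^sup>2 - y\<^sup>2\<close> is congruent to the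
  square of \<open>x - y\<close>. So squaring is injective on the finite residue field, hence
  surjective.\<close>

lemma residue_square_root:
  assumes two: "\<pi> dvd 2"
  obtains c where "\<pi> dvd c\<^sup>2 - a"
proof -
  define rep where "rep C = (SOME y. y \<in> C)" for C :: "'a set"
  have rep: "\<pi> dvd x - rep (residue_class x)" for x
    unfolding rep_def using someI[of "\<lambda>y. y \<in> residue_class x" x]
    by (simp add: residue_class_def)
  define sq where "sq C = residue_class ((rep C)\<^sup>2)" for C
  have "inj_on sq (residue_field \<pi>)"
  proof (rule inj_onI)
    fix C D assume "C \<in> residue_field \<pi>" "D \<in> residue_field \<pi>" and eq: "sq C = sq D"
    then obtain x y where xy: "C = residue_class x" "D = residue_class y"
      by (auto simp: residue_field_eq)
    let ?x = "rep C" and ?y = "rep D"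
    have "\<pi> dvd ?x\<^sup>2 - ?y\<^sup>2" using eq by (simp add: sq_def residue_class_eq_iff)
    moreover have "(?x - ?y) * (?x - ?y) = (?x\<^sup>2 - ?y\<^sup>2) - 2 * (?y * (?x - ?y))"
      by (simp add: power2_eq_square algebra_simps)
    ultimately have "\<pi> dvd ?x - ?y"
      using two by (metis dvd_diff dvd_mult2 dvd_mult_iff)
    then have "residue_class ?x = residue_class ?y" by (simp add: residue_class_eq_iff)
    then show "C = D" using rep[of x] rep[of y] by (simp add: xy flip: residue_class_eq_iff)
  qed
  moreover have "sq ` residue_field \<pi> \<subseteq> residue_field \<pi>"
    by (auto simp: sq_def residue_field_eq)
  ultimately have "sq ` residue_field \<pi> = residue_field \<pi>"
    using finite_residue_field by (intro endo_inj_surj)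
  then have "residue_class a \<in> sq ` residue_field \<pi>" by (simp add: residue_field_eq)
  then show thesis using that by (auto simp: sq_def residue_class_eq_iff dest: sym)
qed

text \<open>With \<open>d = Y $ s $ s - Y $ r $ r\<close> and \<open>z = Y $ s $ r\<close> this
  quadratic is the \<open>r\<close>, \<open>s\<close> entry of \<open>conj_diff r s a Y\<close>. If
  \<open>z\<close> is a unit, its residual roots are 0 and \<open>d / z\<close>.\<close>

lemma avoid_quadratic_roots:
  assumes "\<not> \<pi> dvd d \<or> \<not> \<pi> dvd z"
  obtains a where "\<not> \<pi> dvd a * (d - a * z)"
proof (cases "\<pi> dvd z")
  case True
  then have "\<not> \<pi> dvd 1 * (d - 1 * z)" using assms by (simp add: dvd_diff_left_iff)
  then show thesis using that by blast
next
  case False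
  then obtain y where y: "z * y = 1" by (rule unit_if_not_dvd)
  obtain a where a: "\<And>f. f \<in> {0, d * y} \<Longrightarrow> \<not> \<pi> dvd a - f"
    by (rule avoid_residues[of "{0, d * y}"]) (auto simp: card_insert_if)
  have "d - a * z = - z * (a - d * y)" using y by (simp add: algebra_simps)
  then have "\<not> \<pi> dvd a * (d - a * z)"
    using a[of 0] a[of "d * y"] False by (simp add: dvd_mult_iff)
  then show thesis using that by blast
qed

subsection \<open>Generation of the special linear group by transvections\<close>

context
  fixes S :: "('a^'n::finite^'n) set"
  assumes one_in: "mat 1 \<in> S"
    and mult_in: "\<And>A B. A \<in> S \<Longrightarrow> B \<in> S \<Longrightarrow> A ** B \<in> S"
    and transvection_in: "\<And>r s a. r \<noteq> s \<Longrightarrow> transvection r s a \<in> S"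
begin

text \<open>\<open>S\<close> is only a monoid, but a row operation is undone by another
  transvection, so membership can be tested after elimination.\<close>

lemma in_if_row_operation:
  assumes "r \<noteq> s" "transvection r s a ** A \<in> S" shows "A \<in> S"
proof -
  have "transvection r s (- a) ** (transvection r s a ** A) = A"
    using transvection_inverse[OF assms(1), of "- a"] by (simp add: matrix_mul_assoc)
  then show ?thesis using mult_in[OF transvection_in[OF assms(1)] assms(2)] by metis
qed

lemma in_if_column_operation:
  assumes "r \<noteq> s" "A ** transvection r s a \<in> S" shows "A \<in> S"
proof -
  have "(A ** transvection r s a) ** transvection r s (- a) = A"
    using transvection_inverse[OF assms(1), of a] by (simp flip: matrix_mul_assoc)
  then show ?thesis using mult_in[OF assms(2) transvection_in[OF assms(1)]] by metis
qed

text \<open>Marks an index whose elimination is finished; the recursion enlarges a set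
  \<open>T\<close> of such indices.\<close>

definition clean_cross :: "'n \<Rightarrow> 'a^'n^'n \<Rightarrow> bool" where
  "clean_cross t A \<longleftrightarrow> (\<forall>i. A $ i $ t = mat 1 $ i $ t \<and> A $ t $ i = mat 1 $ t $ i)"

text \<open>The pivot clears column \<open>r\<close> by row operations and row \<open>r\<close> by
  column operations; the induction counts the nonzero entries left there. A nonzero entry at
  \<open>j\<close> forces \<open>j\<close> outside \<open>T\<close>, so finished crosses stay
  clean.\<close>

lemma in_if_pivot_one:
  assumes IH: "\<And>B. det B = 1 \<Longrightarrow> \<forall>t\<in>insert r T. clean_cross t B \<Longrightarrow> B \<in> S"
    and "r \<notin> T" "det A = 1" "\<forall>t\<in>T. clean_cross t A" "A $ r $ r = 1"
  shows "A \<in> S"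
  using assms(3-)
proof (induction "card {j. j \<noteq> r \<and> A $ j $ r \<noteq> 0} + card {j. j \<noteq> r \<and> A $ r $ j \<noteq> 0}"
    arbitrary: A rule: less_induct)
  case less
  consider j where "j \<noteq> r" "A $ j $ r \<noteq> 0" | j where "j \<noteq> r" "A $ r $ j \<noteq> 0"
    | "\<forall>j. j \<noteq> r \<longrightarrow> A $ j $ r = 0 \<and> A $ r $ j = 0" by blast
  then show ?case
  proof cases
    case 1
    have jT: "j \<notin> T" using 1 less.prems(2) \<open>r \<notin> T\<close> by (auto simp: clean_cross_def mat_nth)
    let ?B = "transvection j r (- A $ j $ r) ** A"
    have "{i. i \<noteq> r \<and> ?B $ i $ r \<noteq> 0} \<subset> {i. i \<noteq> r \<and> A $ i $ r \<noteq> 0}"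
      using 1 less.prems(3) by (auto simp: transvection_mult_nth split: if_splits)
    then have "card {i. i \<noteq> r \<and> ?B $ i $ r \<noteq> 0} < card {i. i \<noteq> r \<and> A $ i $ r \<noteq> 0}"
      by (intro psubset_card_mono) auto
    moreover have "{i. i \<noteq> r \<and> ?B $ r $ i \<noteq> 0} = {i. i \<noteq> r \<and> A $ r $ i \<noteq> 0}"
      using 1 by (auto simp: transvection_mult_nth)
    ultimately have "?B \<in> S"
      using 1 jT \<open>r \<notin> T\<close> less.prems
      by (intro less.hyps) (auto simp: det_mul det_transvection transvection_mult_nth
        clean_cross_def mat_nth)
    then show ?thesis using in_if_row_operation[OF 1(1)] by blast
  next
    case 2
    have jT: "j \<notin> T" using 2 less.prems(2) \<open>r \<notin> T\<close> by (auto simp: clean_cross_def mat_nth)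
    let ?B = "A ** transvection r j (- A $ r $ j)"
    have "{i. i \<noteq> r \<and> ?B $ r $ i \<noteq> 0} \<subset> {i. i \<noteq> r \<and> A $ r $ i \<noteq> 0}"
      using 2 less.prems(3) by (auto simp: mult_transvection_nth split: if_splits)
    then have "card {i. i \<noteq> r \<and> ?B $ r $ i \<noteq> 0} < card {i. i \<noteq> r \<and> A $ r $ i \<noteq> 0}"
      by (intro psubset_card_mono) auto
    moreover have "{i. i \<noteq> r \<and> ?B $ i $ r \<noteq> 0} = {i. i \<noteq> r \<and> A $ i $ r \<noteq> 0}"
      using 2 by (auto simp: mult_transvection_nth)
    ultimately have "?B \<in> S"
      using 2 jT \<open>r \<notin> T\<close> less.prems
      by (intro less.hyps) (auto simp: det_mul det_transvection mult_transvection_nth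
        clean_cross_def mat_nth)
    then show ?thesis using in_if_column_operation[of r j] 2 by metis
  next
    case 3
    then have "clean_cross r A" using less.prems(3) by (auto simp: clean_cross_def mat_nth)
    then show ?thesis using IH less.prems by blast
  qed
qed

lemma in_if_unit_in_row:
  assumes IH: "\<And>B. det B = 1 \<Longrightarrow> \<forall>t\<in>insert r T. clean_cross t B \<Longrightarrow> B \<in> S"
    and "r \<notin> T" "det A = 1" "\<forall>t\<in>T. clean_cross t A"
    and i: "i \<noteq> r" "i \<notin> T" "\<not> \<pi> dvd A $ r $ i"
  shows "A \<in> S"
proof -
  obtain y where y: "A $ r $ i * y = 1" using i(3) by (rule unit_if_not_dvd)
  \<comment> \<open>The coefficient solves \<open>A $ r $ r + x * A $ r $ i = 1\<close>, so the new
    pivot is 1.\<close>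
  let ?B = "A ** transvection i r ((1 - A $ r $ r) * y)"
  have "?B \<in> S"
  proof (rule in_if_pivot_one[OF IH \<open>r \<notin> T\<close>])
    show "?B $ r $ r = 1"
    proof -
      have "(1 - A $ r $ r) * y * A $ r $ i = 1 - A $ r $ r"
        using y by (metis mult.assoc mult.commute mult_1_right)
      then have "A $ r $ r + (1 - A $ r $ r) * y * A $ r $ i = 1" by (metis diff_add_cancel add.commute)
      then show ?thesis by (simp add: mult_transvection_nth)
    qed
  qed (use assms in \<open>auto simp: det_mul det_transvection mult_transvection_nth
      clean_cross_def mat_nth\<close>)
  then show ?thesis using in_if_column_operation i(1) by blast
qed

text \<open>Gaussian elimination over a local ring: determinant 1 forces a unit into every row, from
  which a pivot 1 is made. Once at most one index is unfinished, the matrix is diagonal and the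
  determinant fixes the last entry.\<close>

theorem det_one_in_if_transvections_in:
  assumes "det A = 1" shows "A \<in> S"
proof -
  have "A \<in> S" if "det A = 1" "\<forall>t\<in>T. clean_cross t A" for A and T :: "'n set"
    using that
  proof (induction "card (- T)" arbitrary: A T rule: less_induct)
    case less
    show ?case
    proof (cases "\<exists>r s. r \<noteq> s \<and> r \<notin> T \<and> s \<notin> T")
      case True
      then obtain r s where rs: "r \<noteq> s" "r \<notin> T" "s \<notin> T" by blast
      have IH: "B \<in> S" if "det B = 1" "\<forall>t\<in>insert r T. clean_cross t B" for B
      proof (rule less.hyps[OF _ that])
        show "card (- insert r T) < card (- T)"
          using rs by (intro psubset_card_mono) auto
      qed
      have "\<exists>i. \<not> \<pi> dvd A $ r $ i"
        using dvd_det_if_dvd_row[of \<pi> A r] less.prems(1) not_dvd_one by auto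
      then obtain i where i: "\<not> \<pi> dvd A $ r $ i" by blast
      show ?thesis
      proof (cases "\<exists>i. i \<noteq> r \<and> \<not> \<pi> dvd A $ r $ i")
        case True
        then obtain i where i: "i \<noteq> r" "\<not> \<pi> dvd A $ r $ i" by blast
        then have "i \<notin> T" using less.prems(2) \<open>r \<notin> T\<close> by (auto simp: clean_cross_def mat_nth)
        then show ?thesis using in_if_unit_in_row[OF IH] i less.prems rs by blast
      next
        case False
        \<comment> \<open>The only unit of row \<open>r\<close> is on the diagonal; adding column
          \<open>r\<close> to column \<open>s\<close> makes one off the diagonal.\<close>
        let ?B = "A ** transvection r s 1"
        have s: "\<pi> dvd A $ r $ s" using False rs(1) by auto
        have "\<not> \<pi> dvd A $ r $ r" using False i by auto
        then have "\<not> \<pi> dvd ?B $ r $ s"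
          using s by (simp add: mult_transvection_nth dvd_add_right_iff)
        then have "?B \<in> S"
          using rs less.prems by (intro in_if_unit_in_row[OF IH, where i = s])
            (auto simp: det_mul det_transvection mult_transvection_nth clean_cross_def mat_nth)
        then show ?thesis using in_if_column_operation rs(1) by blast
      qed
    next
      case False
      have diag: "A $ i $ j = mat 1 $ i $ j" if "i \<in> T \<or> j \<in> T" for i j
        using less.prems(2) that by (auto simp: clean_cross_def)
      have off: "A $ i $ j = 0" if "i \<noteq> j" for i j
        using diag[of i j] False that by (auto simp: mat_nth)
      have "A = mat 1"
      proof (cases "T = UNIV")
        case True
        then show ?thesis using diag by (simp add: vec_eq_iff)
      next
        case nU: False
        then obtain s where s: "s \<notin> T" by blast
        have "det A = (\<Prod>i\<in>UNIV. A $ i $ i)" by (rule det_diagonal) (use off in auto)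
        also have "\<dots> = A $ s $ s * (\<Prod>i\<in>UNIV - {s}. A $ i $ i)" by (subst prod.remove[of _ s]) auto
        also have "(\<Prod>i\<in>UNIV - {s}. A $ i $ i) = 1"
        proof (intro prod.neutral ballI)
          fix i assume "i \<in> UNIV - {s}"
          then have "i \<in> T" using False s by blast
          then show "A $ i $ i = 1" using diag by (simp add: mat_nth)
        qed
        finally have "A $ s $ s = 1" using less.prems(1) by simp
        then have "A $ i $ i = 1" for i
          using diag[of i i] False s by (cases "i = s") (auto simp: mat_nth)
        then show ?thesis using off by (simp add: vec_eq_iff mat_nth)
      qed
      then show ?thesis using one_in by simp
    qed
  qed
  from this[of A "{}"] show ?thesis using assms by simp
qed

end

end

section \<open>Modules of matrices stable under transvections\<close>

text \<open>This is \<open>u X u\<inverse> - X\<close> for the transvection \<open>u = 1 + a E\<^sub>r\<^sub>s\<close>.\<close>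
definition conj_diff :: "'n::finite \<Rightarrow> 'n \<Rightarrow> 'a::comm_ring_1 \<Rightarrow> 'a^'n^'n \<Rightarrow> 'a^'n^'n" where
  "conj_diff r s a X =
     single r s a ** X - X ** single r s a - single r s a ** X ** single r s a"

lemma conj_diff_nth:
  "conj_diff r s a X $ i $ j = (if i = r then a * X $ s $ j else 0) -
     (if j = s then a * X $ i $ r else 0) - (if i = r \<and> j = s then a * a * X $ s $ r else 0)"
  by (simp add: conj_diff_def single_mult_nth mult_single_nth)

text \<open>\<open>M\<close> stands for an additive group of matrices over the residue field, given
  by all their lifts. Closure under scalars is not assumed, so multiples of a matrix unit have to be
  produced by varying the transvection.\<close>

locale transvection_stable_module = large_residue_dvr \<pi> for \<pi> :: "'a::idom" +
  fixes M :: "('a^'n::finite^'n) set"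
  assumes add_in: "X \<in> M \<Longrightarrow> Y \<in> M \<Longrightarrow> X + Y \<in> M"
    and uminus_in: "X \<in> M \<Longrightarrow> - X \<in> M"
    and zero_in: "0 \<in> M"
    and cong_in: "X \<in> M \<Longrightarrow> mat_cong \<pi> 1 X Y \<Longrightarrow> Y \<in> M"
    and conj_diff_in: "r \<noteq> s \<Longrightarrow> X \<in> M \<Longrightarrow> conj_diff r s a X \<in> M"
begin

lemma diff_in: "X \<in> M \<Longrightarrow> Y \<in> M \<Longrightarrow> X - Y \<in> M"
  using add_in[OF _ uminus_in, of X Y] by simp

lemma sum_in: "(\<And>i. i \<in> I \<Longrightarrow> f i \<in> M) \<Longrightarrow> sum f I \<in> M"
  by (induction I rule: infinite_finite_induct) (auto intro: add_in zero_in)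

section \<open>Root spaces and the matrices of trace zero\<close>

definition has_root_space :: "'n \<Rightarrow> 'n \<Rightarrow> bool" where
  "has_root_space r s \<longleftrightarrow> r \<noteq> s \<and> (\<forall>a. single r s a \<in> M)"

lemma has_root_spaceI_unit:
  assumes "r \<noteq> s" "\<not> \<pi> dvd y" "\<And>c. single r s (c * y) \<in> M"
  shows "has_root_space r s"
proof -
  obtain y' where "y * y' = 1" using assms(2) by (rule unit_if_not_dvd)
  then have "a = (a * y') * y" for a by (simp add: mult_ac)
  then show ?thesis using assms unfolding has_root_space_def by metis
qed

text \<open>Conjugating \<open>c E_rs\<close> by \<open>1 + b E_sr\<close> adds
  \<open>bc (E_ss - E_rr) - b^2 c E_sr\<close>. Two choices with the same product \<open>bc\<close>
  cancel the diagonal part and leave \<open>b (b - 1) c E_sr\<close>, where \<open>b (b - 1)\<close>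
  is a unit.\<close>

lemma has_root_space_flip:
  assumes "has_root_space r s" shows "has_root_space s r"
proof -
  have rs: "r \<noteq> s" and M: "single r s a \<in> M" for a
    using assms by (auto simp: has_root_space_def)
  obtain b where b: "\<And>f. f \<in> {0, 1} \<Longrightarrow> \<not> \<pi> dvd b - f"
    by (rule avoid_residues[of "{0, 1}"]) auto
  have "\<not> \<pi> dvd b * (b - 1)" using b[of 0] b[of 1] by (simp add: dvd_mult_iff)
  moreover have "single s r (c * (b * (b - 1))) =
      conj_diff s r 1 (single r s (c * b)) - conj_diff s r b (single r s c)" for c
    using rs by (auto simp: vec_eq_iff conj_diff_nth algebra_simps)
  then have "single s r (c * (b * (b - 1))) \<in> M" for c
    using rs M by (simp add: diff_in conj_diff_in)
  ultimately show ?thesis using rs by (intro has_root_spaceI_unit) auto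
qed

lemma has_root_space_move_row:
  assumes "has_root_space r s" "j \<noteq> s" shows "has_root_space j s"
proof (cases "j = r")
  case False
  have "single j s a = conj_diff j r 1 (single r s a)" for a
    using assms False by (auto simp: vec_eq_iff conj_diff_nth has_root_space_def)
  then show ?thesis
    using assms conj_diff_in[OF False] by (metis has_root_space_def)
qed (use assms in simp)

text \<open>A column is moved by a flip, a row move and a flip back, so one root space reaches every
  other.\<close>

lemma has_root_space_all:
  assumes rs: "has_root_space r s" and "i \<noteq> j" shows "has_root_space i j"
proof -
  have "has_root_space i j" if "has_root_space i t" for t
    using has_root_space_flip[OF has_root_space_move_row[OF has_root_space_flip[OF that], of j]]
      \<open>i \<noteq> j\<close> by simp
  then show ?thesis
    using has_root_space_move_row[OF rs, of i] has_root_space_flip[OF rs] by (cases "i = s") auto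
qed

lemma coroot_in:
  assumes "has_root_space r s"
  shows "single s s a - single r r a \<in> M"
proof -
  have "r \<noteq> s" using assms by (simp add: has_root_space_def)
  then have "single s s a - single r r a = conj_diff s r 1 (single r s a) + single s r a"
    by (auto simp: vec_eq_iff conj_diff_nth)
  then show ?thesis
    using assms has_root_space_flip[OF assms] by (simp add: has_root_space_def add_in conj_diff_in)
qed

text \<open>\<open>X\<close> is a sum of root vectors and multiples of \<open>E_ii - E_ss\<close>,
  up to the trace placed at \<open>E_ss\<close>, which vanishes residually.\<close>

lemma trace_zero_in:
  assumes rs: "has_root_space r s" and tr: "\<pi> dvd (\<Sum>i\<in>UNIV. X $ i $ i)"
  shows "X \<in> M"
proof -
  define F where "F i j = single i j (X $ i $ j) - (if i = j then single s s (X $ i $ i) else 0)"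
    for i j
  have "F i j \<in> M" for i j
  proof (cases "i = j")
    case True
    then show ?thesis
    proof (cases "i = s")
      case False
      then have "has_root_space s i" by (intro has_root_space_all[OF rs]) simp
      from coroot_in[OF this, of "X $ i $ i"] show ?thesis using True by (simp add: F_def)
    qed (simp add: F_def zero_in)
  next
    case False
    then show ?thesis
      using has_root_space_all[OF rs, of i j] by (simp add: F_def has_root_space_def)
  qed
  then have "(\<Sum>i\<in>UNIV. \<Sum>j\<in>UNIV. F i j) \<in> M" by (intro sum_in) auto
  moreover have "(\<Sum>i\<in>UNIV. \<Sum>j\<in>UNIV. F i j) = X - single s s (\<Sum>i\<in>UNIV. X $ i $ i)"
  proof -
    have "(\<Sum>i\<in>UNIV. \<Sum>j\<in>UNIV. F i j $ u $ v) = (X - single s s (\<Sum>i\<in>UNIV. X $ i $ i)) $ u $ v"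
      for u v
    proof -
      have "F i j $ u $ v = (if i = u then if j = v then X $ u $ v else 0 else 0) -
          (if j = i then if u = s \<and> v = s then X $ i $ i else 0 else 0)" for i j
        by (auto simp: F_def)
      then show ?thesis by (simp add: sum_subtractf sum.If_cases)
    qed
    then show ?thesis by (simp add: vec_eq_iff)
  qed
  ultimately have "X - single s s (\<Sum>i\<in>UNIV. X $ i $ i) \<in> M" by simp
  then show ?thesis by (rule cong_in) (use tr in \<open>auto simp: mat_cong_def\<close>)
qed

text \<open>Polarization: \<open>conj_diff r s a Z\<close> is quadratic in \<open>a\<close>, and its
  second difference isolates the quadratic part, a multiple of \<open>E_rs\<close>.\<close>

lemma has_root_space_if_two_unit:
  assumes "Z \<in> M" "r \<noteq> s" "\<not> \<pi> dvd Z $ s $ r" "\<not> \<pi> dvd 2"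
  shows "has_root_space r s"
proof (rule has_root_spaceI_unit)
  show "\<not> \<pi> dvd 2 * Z $ s $ r" using assms by (simp add: dvd_mult_iff)
  fix c
  have "single r s (c * (2 * Z $ s $ r)) =
      conj_diff r s 1 Z + conj_diff r s c Z - conj_diff r s (1 + c) Z"
    by (auto simp: vec_eq_iff conj_diff_nth algebra_simps)
  then show "single r s (c * (2 * Z $ s $ r)) \<in> M"
    using assms by (simp add: add_in diff_in conj_diff_in)
qed fact

text \<open>A second difference, along \<open>r\<close>, \<open>t\<close>, removes the quadratic
  term and leaves an expression linear in \<open>a\<close>. Its \<open>E_rs\<close> part either
  vanishes residually or is carried to \<open>E_rt\<close> by a third one.\<close>

lemma has_root_space_if_third_index:
  assumes "Z \<in> M" "r \<noteq> s" "\<not> \<pi> dvd Z $ s $ r" "t \<noteq> r" "t \<noteq> s"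
  shows "has_root_space r t"
proof -
  have W: "single r s (a * Z $ t $ r) + single r t (a * Z $ s $ r) \<in> M" for a
  proof -
    have "single r s (a * Z $ t $ r) + single r t (a * Z $ s $ r) =
        - conj_diff r t 1 (conj_diff r s a Z)"
      using assms by (auto simp: vec_eq_iff conj_diff_nth)
    then show ?thesis using assms by (simp add: uminus_in conj_diff_in)
  qed
  show ?thesis
  proof (cases "\<pi> dvd Z $ t $ r")
    case True
    have "single r t (a * Z $ s $ r) \<in> M" for a
      by (rule cong_in[OF W[of a]]) (use True assms in \<open>auto simp: mat_cong_def\<close>)
    then show ?thesis using assms by (intro has_root_spaceI_unit[of r t "Z $ s $ r"]) auto
  next
    case False
    have "single r t (a * Z $ t $ r) \<in> M" for a
    proof -
      have "single r t (a * Z $ t $ r) =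
        - conj_diff s t 1 (single r s (a * Z $ t $ r) + single r t (a * Z $ s $ r))"
        using assms by (auto simp: vec_eq_iff conj_diff_nth)
      then show ?thesis using assms W by (simp add: uminus_in conj_diff_in)
    qed
    then show ?thesis using assms False
      by (intro has_root_spaceI_unit[of r t "Z $ t $ r"]) auto
  qed
qed

text \<open>In characteristic two, \<open>b \<mapsto> conj_diff s r b\<close> sends \<open>d(E\<^sub>r\<^sub>r - E\<^sub>s\<^sub>s) + e E\<^sub>r\<^sub>s\<close> to
  \<open>be\<cdot>1 + b\<^sup>2e E\<^sub>s\<^sub>r\<close>. Two different values of \<open>e\<close> allow the scalar part to be cancelled, which
  leaves square multiples of a fixed unit; every residue is a square.\<close>
lemma has_root_space_if_two_indices:
  assumes "Z \<in> M" "r \<noteq> s" "UNIV = {r, s}" "\<not> \<pi> dvd Z $ s $ r" "\<pi> dvd 2"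
  shows "has_root_space s r"
proof -
  define z d where "z = Z $ s $ r" and "d = Z $ s $ s - Z $ r $ r"
  \<comment> \<open>\<open>e a\<close> is the \<open>r\<close>, \<open>s\<close> entry of
    \<open>conj_diff r s a Z\<close>; its residual roots are 0 and \<open>\<rho>\<close>.\<close>
  define e where "e a = a * (d - a * z)" for a
  obtain z' where "z * z' = 1" using assms(4) unit_if_not_dvd z_def by metis
  define \<rho> where "\<rho> = d * z'"
  have "d = z * \<rho>" using \<open>z * z' = 1\<close> by (simp add: \<rho>_def mult_ac)
  then have e: "e a = - (z * (a * (a - \<rho>)))" for a
    by (simp add: e_def algebra_simps)
  obtain a1 where a1: "\<And>f. f \<in> {0, \<rho>} \<Longrightarrow> \<not> \<pi> dvd a1 - f"
    by (rule avoid_residues[of "{0, \<rho>}"]) (auto simp: card_insert_if)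
  \<comment> \<open>The values \<open>a1\<close> and \<open>\<rho> - a1\<close> are exactly those at
    which \<open>e\<close> takes the residual value \<open>e a1\<close>.\<close>
  obtain a2 where a2: "\<And>f. f \<in> {0, \<rho>, a1, \<rho> - a1} \<Longrightarrow> \<not> \<pi> dvd a2 - f"
    by (rule avoid_residues[of "{0, \<rho>, a1, \<rho> - a1}"]) (auto simp: card_insert_if)
  define y where "y = e a1 * e a2 * (e a1 - e a2)"
  have "e a1 - e a2 = z * ((a2 - a1) * (a2 - (\<rho> - a1)))"
    by (simp add: e algebra_simps)
  then have "\<not> \<pi> dvd e a1 - e a2" using a2[of a1] a2[of "\<rho> - a1"] assms(4)
    by (simp add: dvd_mult_iff z_def)
  moreover have "\<not> \<pi> dvd e a1" using a1[of 0] a1[of \<rho>] assms(4)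
    by (simp add: e dvd_mult_iff z_def)
  moreover have "\<not> \<pi> dvd e a2" using a2[of 0] a2[of \<rho>] assms(4)
    by (simp add: e dvd_mult_iff z_def)
  ultimately have y: "\<not> \<pi> dvd y" by (simp add: y_def dvd_mult_iff)
  \<comment> \<open>The parameters \<open>e a2 * c\<close> and \<open>e a1 * c\<close> below give
    both terms the same diagonal part, which cancels. \<open>w c\<close> collects what carries a
    factor 2.\<close>
  define w where "w c = 2 * (e a2 * c * a1 - e a1 * c * a2) * z" for c
  have "single s r (w c + c\<^sup>2 * y) $ i $ j = (conj_diff s r (e a2 * c) (conj_diff r s a1 Z) -
      conj_diff s r (e a1 * c) (conj_diff r s a2 Z)) $ i $ j" for c i j
  proof -
    have "i \<in> {r, s}" "j \<in> {r, s}" using assms(3) by blast+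
    then show ?thesis
      using assms(2)
      by (elim insertE emptyE) (auto simp: conj_diff_nth w_def y_def e_def z_def d_def
          power2_eq_square algebra_simps)
  qed
  then have "single s r (w c + c\<^sup>2 * y) = conj_diff s r (e a2 * c) (conj_diff r s a1 Z) -
      conj_diff s r (e a1 * c) (conj_diff r s a2 Z)" for c
    by (simp only: vec_eq_iff) blast
  then have square: "single s r (w c + c\<^sup>2 * y) \<in> M" for c
    using assms(1,2) by (simp add: diff_in conj_diff_in)
  have "single s r (a * y) \<in> M" for a
  proof -
    obtain c where c: "\<pi> dvd c\<^sup>2 - a" using residue_square_root[OF assms(5)] by blast
    have eq: "w c + c\<^sup>2 * y - a * y = w c + (c\<^sup>2 - a) * y" by (simp add: algebra_simps)
    have "\<pi> dvd w c" using assms(5) by (simp add: w_def)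
    then have "\<pi> dvd w c + c\<^sup>2 * y - a * y" unfolding eq using c by (intro dvd_add dvd_mult2)
    then show ?thesis by (intro cong_in[OF square[of c]]) (simp add: mat_cong_def)
  qed
  then show ?thesis using assms(2) y by (intro has_root_spaceI_unit) auto
qed

text \<open>A non-root of the quadratic entry gives some \<open>Z\<close> in \<open>M\<close> with a
  unit off the diagonal. From it one root space arises by polarization, by a third index or by the
  argument with squares, and one suffices. \<open>Y\<close> itself may lie outside
  \<open>M\<close>.\<close>

theorem trace_zero_in_if_nonscalar:
  fixes Y :: "'a^'n^'n"
  assumes nonscalar: "\<not> (\<exists>c. mat_cong \<pi> 1 Y (mat c))"
    and Y: "\<And>r s a. r \<noteq> s \<Longrightarrow> conj_diff r s a Y \<in> M"
    and tr: "\<pi> dvd (\<Sum>i\<in>UNIV. X $ i $ i)"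
  shows "X \<in> M"
proof -
  have "\<exists>r s. r \<noteq> s \<and> (\<not> \<pi> dvd Y $ s $ s - Y $ r $ r \<or> \<not> \<pi> dvd Y $ s $ r)"
  proof (rule ccontr)
    assume "\<not> ?thesis"
    then have "\<pi> dvd Y $ i $ i - Y $ j $ j \<and> \<pi> dvd Y $ i $ j" if "i \<noteq> j" for i j
      using that by metis
    then have "\<pi> dvd Y $ i $ j - mat (Y $ t $ t) $ i $ j" for i j t
      by (cases "i = j"; cases "j = t") (simp_all add: mat_nth)
    then have "mat_cong \<pi> 1 Y (mat (Y $ t $ t))" for t
      by (simp add: mat_cong_def)
    then show False using nonscalar by blast
  qed
  then obtain r s where rs: "r \<noteq> s"
    and "\<not> \<pi> dvd Y $ s $ s - Y $ r $ r \<or> \<not> \<pi> dvd Y $ s $ r" by blast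
  then obtain a where a: "\<not> \<pi> dvd a * (Y $ s $ s - Y $ r $ r - a * Y $ s $ r)"
    using avoid_quadratic_roots by metis
  define Z where "Z = conj_diff r s a Y"
  have Z: "Z \<in> M" "\<not> \<pi> dvd Z $ r $ s"
    using Y[OF rs] a rs by (simp_all add: Z_def conj_diff_nth algebra_simps)
  have "\<exists>i j. has_root_space i j"
  proof (cases "\<pi> dvd 2")
    case False
    then show ?thesis using has_root_space_if_two_unit[of Z s r] Z rs by blast
  next
    case two: True
    show ?thesis
    proof (cases "UNIV = {r, s}")
      case True
      then show ?thesis
        using has_root_space_if_two_indices[of Z s r] Z rs two by (auto simp: insert_commute)
    next
      case False
      then obtain t where "t \<noteq> r" "t \<noteq> s" by blast
      then show ?thesis using has_root_space_if_third_index[of Z s r t] Z rs by blast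
    qed
  qed
  then show ?thesis using trace_zero_in tr by blast
qed

end

section \<open>Diagonal matrices\<close>

definition diag_mat :: "('n::finite \<Rightarrow> 'a::comm_ring_1) \<Rightarrow> 'a^'n^'n" where
  "diag_mat d = (\<chi> i j. if i = j then d i else 0)"

lemma diag_mat_nth: "diag_mat d $ i $ j = (if i = j then d i else 0)"
  by (simp add: diag_mat_def)

lemma diag_mat_mult_nth: "(diag_mat d ** X) $ i $ j = d i * X $ i $ j"
  by (simp add: matrix_matrix_mult_def diag_mat_def if_distrib[of "\<lambda>x. x * _"] cong: if_cong)

lemma mult_diag_mat_nth: "(X ** diag_mat d) $ i $ j = d j * X $ i $ j"
  by (simp add: matrix_matrix_mult_def diag_mat_def if_distrib[of "\<lambda>x. _ * x"] mult.commute
      cong: if_cong)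

lemma det_diag_mat: "det (diag_mat d) = prod d UNIV"
  by (subst det_diagonal) (auto simp: diag_mat_def)

text \<open>In use \<open>y\<close> is the inverse of \<open>t\<close>, passed explicitly because an
  integral domain has no inverse operation.\<close>

definition torus :: "'n::finite \<Rightarrow> 'n \<Rightarrow> 'a::comm_ring_1 \<Rightarrow> 'a \<Rightarrow> 'a^'n^'n" where
  "torus r s t y = diag_mat (\<lambda>i. if i = r then t else if i = s then y else 1)"

lemma det_torus:
  assumes "r \<noteq> s" shows "det (torus r s t y) = t * y"
proof -
  let ?d = "\<lambda>i. if i = r then t else if i = s then y else 1"
  have "prod ?d UNIV = ?d r * prod ?d (UNIV - {r})" by (rule prod.remove) auto
  also have "prod ?d (UNIV - {r}) = ?d s * prod ?d (UNIV - {r} - {s})"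
    using assms by (intro prod.remove) auto
  also have "prod ?d (UNIV - {r} - {s}) = 1" by (rule prod.neutral) auto
  finally show ?thesis using assms by (simp add: torus_def det_diag_mat)
qed

section \<open>Approximating special linear matrices by the derived group\<close>

lemma is_mat_inverse_unique:
  "is_mat_inverse a b \<Longrightarrow> is_mat_inverse a c \<Longrightarrow> b = c"
  by (metis is_mat_inverse_def matrix_mul_assoc matrix_mul_lid matrix_mul_rid)

lemma det_is_mat_inverse: "is_mat_inverse a b \<Longrightarrow> det a * det b = 1"
  by (metis is_mat_inverse_def det_mul det_I)

lemma derived_subgroup_det: "x \<in> derived_subgroup H \<Longrightarrow> det x = 1"
  unfolding derived_subgroup_def
proof (induction rule: gen_subgroup.induct)
  case (gen x)
  then obtain a b a' b' where x: "x = a ** b ** a' ** b'"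
    and inv: "is_mat_inverse a a'" "is_mat_inverse b b'"
    by (auto simp: commutators_def)
  have "det x = (det a * det a') * (det b * det b')" by (simp add: x det_mul mult_ac)
  then show ?case using inv by (simp add: det_is_mat_inverse)
next
  case (inv a b)
  then show ?case using det_is_mat_inverse[OF inv.hyps(2)] by simp
qed (simp_all add: det_mul)

locale residually_full_group = large_residue_dvr \<pi> for \<pi> :: "'a::idom" +
  fixes H :: "('a^'n::finite^'n) set"
  assumes subgroup: "is_subgroup_GL H" and residually_full: "SLk_in_H0 \<pi> H"
begin

abbreviation "D \<equiv> derived_subgroup H"

lemma group_inverse:
  assumes "a \<in> H" obtains b where "b \<in> H" "is_mat_inverse a b"
  using assms subgroup by (auto simp: is_subgroup_GL_def)

lemma inverse_in_group: "a \<in> H \<Longrightarrow> is_mat_inverse a b \<Longrightarrow> b \<in> H"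
  using group_inverse is_mat_inverse_unique by metis

lemma mult_in_group: "a \<in> H \<Longrightarrow> b \<in> H \<Longrightarrow> a ** b \<in> H"
  using subgroup by (auto simp: is_subgroup_GL_def)

lemma derived_subgroup_subset: "x \<in> D \<Longrightarrow> x \<in> H"
  unfolding derived_subgroup_def
proof (induction rule: gen_subgroup.induct)
  case one
  then show ?case using subgroup by (simp add: is_subgroup_GL_def)
next
  case (gen x)
  then show ?case by (auto simp: commutators_def intro!: mult_in_group intro: inverse_in_group)
qed (auto intro: mult_in_group inverse_in_group)

lemma commutator_in_derived:
  "a \<in> H \<Longrightarrow> b \<in> H \<Longrightarrow> is_mat_inverse a a' \<Longrightarrow> is_mat_inverse b b' \<Longrightarrow> a ** b ** a' ** b' \<in> D"
  unfolding derived_subgroup_def by (rule gen_subgroup.gen) (auto simp: commutators_def)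

lemma derived_mult: "a \<in> D \<Longrightarrow> b \<in> D \<Longrightarrow> a ** b \<in> D"
  unfolding derived_subgroup_def by (rule gen_subgroup.mult)

lemma derived_one: "mat 1 \<in> D"
  unfolding derived_subgroup_def by (rule gen_subgroup.one)

lemma derived_inverse:
  assumes "a \<in> D" obtains b where "b \<in> D" "is_mat_inverse a b"
  using group_inverse[OF derived_subgroup_subset[OF assms]] assms
  unfolding derived_subgroup_def by (metis gen_subgroup.inv)

text \<open>As \<open>D\<close> lies in \<open>SL\<close>, this says that both have the same image
  modulo \<open>\<pi> ^ m\<close>; for all \<open>m\<close> together it is density of
  \<open>D\<close>.\<close>

definition approximable :: "nat \<Rightarrow> bool" where
  "approximable m \<longleftrightarrow> (\<forall>A. det A = 1 \<longrightarrow> (\<exists>h\<in>D. mat_cong \<pi> m h A))"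

lemma residual_lift:
  assumes "det A = 1" obtains h where "h \<in> H" "mat_cong \<pi> 1 h A"
proof -
  have "\<pi> dvd det A - 1" using assms by simp
  then show thesis using residually_full that unfolding SLk_in_H0_def by blast
qed

lemma approximable_one: "approximable 1"
proof -
  define S where "S = {A. \<exists>h\<in>D. mat_cong \<pi> 1 h A}"
  have "transvection r s a \<in> S" if rs: "r \<noteq> s" for r s a
  proof -
    \<comment> \<open>Conjugation by the diagonal matrix multiplies \<open>E_rs\<close> by
      \<open>t^2\<close>, so the commutator has parameter \<open>(t^2 - 1) b\<close>. Excluding 0, 1
      and -1 makes \<open>t\<close> and \<open>t^2 - 1\<close> units.\<close>
    obtain t where t: "\<And>f. f \<in> {0, 1, -1} \<Longrightarrow> \<not> \<pi> dvd t - f"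
      by (rule avoid_residues[of "{0, 1, -1}"]) (auto simp: card_insert_if)
    obtain y where y: "t * y = 1" using t[of 0] by (auto elim: unit_if_not_dvd)
    have "t * t - 1 = (t - 1) * (t - (-1))" by (simp add: algebra_simps)
    then have "\<not> \<pi> dvd t * t - 1" using t[of 1] t[of "-1"] by (simp add: dvd_mult_iff)
    then obtain z where z: "(t * t - 1) * z = 1" by (rule unit_if_not_dvd)
    define b where "b = z * a"
    have b: "t * t * b - b = a"
    proof -
      have "t * t * b - b = (t * t - 1) * z * a" by (simp add: b_def algebra_simps)
      then show ?thesis using z by simp
    qed
    let ?T = "torus r s t y" and ?T' = "torus r s y t"
    obtain g where g: "g \<in> H" "mat_cong \<pi> 1 g ?T"
      using det_torus[OF rs, of t y] y residual_lift by metis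
    obtain h where h: "h \<in> H" "mat_cong \<pi> 1 h (transvection r s b)"
      using det_transvection[OF rs] residual_lift by metis
    obtain g' h' where inv: "is_mat_inverse g g'" "is_mat_inverse h h'"
      using g(1) h(1) group_inverse by metis
    have "?T ** ?T' = mat 1"
      using y by (auto simp: torus_def vec_eq_iff diag_mat_mult_nth diag_mat_nth mat_nth mult.commute)
    then have "mat_cong \<pi> 1 g' ?T'"
      using mat_cong_inverse[OF g(2)] inv(1) by (simp add: is_mat_inverse_def)
    moreover have "mat_cong \<pi> 1 h' (transvection r s (- b))"
      using mat_cong_inverse[OF h(2) _ transvection_inverse[OF rs]] inv(2)
      by (simp only: is_mat_inverse_def)
    ultimately have "mat_cong \<pi> 1 (g ** h ** g' ** h')
        (?T ** transvection r s b ** ?T' ** transvection r s (- b))"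
      using g(2) h(2) by (intro mat_cong_mult)
    also have "?T ** transvection r s b ** ?T' ** transvection r s (- b) = transvection r s a"
      using y rs b by (auto simp: torus_def vec_eq_iff mult_transvection_nth mult_diag_mat_nth
          diag_mat_mult_nth diag_mat_nth mat_nth algebra_simps)
    finally show ?thesis
      using commutator_in_derived g(1) h(1) inv by (auto simp: S_def)
  qed
  moreover have "mat 1 \<in> S" using derived_one by (auto simp: S_def intro: mat_cong_refl)
  moreover have "A ** B \<in> S" if "A \<in> S" "B \<in> S" for A B
    using that by (auto simp: S_def intro: derived_mult mat_cong_mult)
  ultimately have "A \<in> S" if "det A = 1" for A
    using det_one_in_if_transvections_in that by metis
  then show ?thesis by (auto simp: approximable_def S_def)
qed

subsection \<open>The layers of the congruence filtration\<close>

definition level :: "nat \<Rightarrow> ('a^'n^'n) set" where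
  "level k = {X. \<exists>g\<in>D. mat_cong \<pi> (Suc k) g (mat 1 + smat (\<pi> ^ k) X)}"

lemma level_cong:
  assumes "X \<in> level k" "mat_cong \<pi> 1 X Y" shows "Y \<in> level k"
proof -
  have "mat_cong \<pi> (Suc k) (mat 1 + smat (\<pi> ^ k) X) (mat 1 + smat (\<pi> ^ k) Y)"
    using mat_cong_add[OF mat_cong_refl mat_cong_smat[OF assms(2), of k]] by simp
  then show ?thesis using assms(1) mat_cong_trans unfolding level_def by blast
qed

lemma level_add:
  assumes "k \<ge> 1" "X \<in> level k" "Y \<in> level k" shows "X + Y \<in> level k"
proof -
  obtain g h where gh: "g \<in> D" "mat_cong \<pi> (Suc k) g (mat 1 + smat (\<pi> ^ k) X)"
      "h \<in> D" "mat_cong \<pi> (Suc k) h (mat 1 + smat (\<pi> ^ k) Y)"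
    using assms by (auto simp: level_def)
  obtain l where l: "\<pi> ^ k = \<pi> * l" using assms(1) by (cases k) auto
  have "(mat 1 + smat (\<pi> ^ k) X) ** (mat 1 + smat (\<pi> ^ k) Y) =
      mat 1 + smat (\<pi> ^ k) (X + Y + smat (\<pi> ^ k) (X ** Y))"
    by (simp add: matrix_ring_simps add_ac)
  then have "X + Y + smat (\<pi> ^ k) (X ** Y) \<in> level k"
    using mat_cong_mult[OF gh(2,4)] derived_mult[OF gh(1,3)] by (auto simp: level_def)
  then show ?thesis
    by (rule level_cong) (simp add: mat_cong_def l mult.assoc)
qed

lemma level_zero: "0 \<in> level k"
proof -
  have "mat 1 + smat (\<pi> ^ k) 0 = mat 1" by (simp add: vec_eq_iff)
  then have "mat_cong \<pi> (Suc k) (mat 1) (mat 1 + smat (\<pi> ^ k) 0)" by (metis mat_cong_refl)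
  then show ?thesis using derived_one unfolding level_def by blast
qed

lemma level_uminus:
  assumes "k \<ge> 1" "X \<in> level k" shows "- X \<in> level k"
proof -
  obtain g where g: "g \<in> D" "mat_cong \<pi> (Suc k) g (mat 1 + smat (\<pi> ^ k) X)"
    using assms by (auto simp: level_def)
  obtain g' where g': "g' \<in> D" "is_mat_inverse g g'" using g(1) by (rule derived_inverse)
  obtain l where l: "\<pi> ^ k = \<pi> * l" using assms(1) by (cases k) auto
  let ?M = "mat 1 + smat (\<pi> ^ k) (- X)"
  have "mat_cong \<pi> (Suc k) (g' ** (g ** ?M)) (g' ** ((mat 1 + smat (\<pi> ^ k) X) ** ?M))"
    using g(2) by (intro mat_cong_mult mat_cong_refl)
  moreover have "g' ** (g ** ?M) = ?M"
    using g'(2) by (simp add: matrix_mul_assoc is_mat_inverse_def)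
  moreover have "mat_cong \<pi> (Suc k) ((mat 1 + smat (\<pi> ^ k) X) ** ?M) (mat 1)"
  proof -
    have "(mat 1 + smat (\<pi> ^ k) X) ** ?M = mat 1 + smat (\<pi> ^ Suc k) (smat l (X ** (- X)))"
      by (simp add: matrix_ring_simps l vec_eq_iff algebra_simps)
    then show ?thesis unfolding mat_cong_iff by blast
  qed
  then have "mat_cong \<pi> (Suc k) (g' ** ((mat 1 + smat (\<pi> ^ k) X) ** ?M)) (g' ** mat 1)"
    by (intro mat_cong_mult mat_cong_refl)
  ultimately have "mat_cong \<pi> (Suc k) g' ?M"
    using mat_cong_trans mat_cong_sym by (metis matrix_mul_rid)
  then show ?thesis using g'(1) by (auto simp: level_def)
qed

text \<open>The group commutator is \<open>1 + (ug - gu) u' g'\<close>, so its layer can be read off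
  from the additive commutator.\<close>

lemma level_commutator:
  assumes "u \<in> H" "g \<in> H" "is_mat_inverse u u'" "is_mat_inverse g g'"
    and X: "u ** g - g ** u = smat (\<pi> ^ k) X" and "mat_cong \<pi> 1 (X ** u' ** g') Y"
  shows "Y \<in> level k"
proof -
  have "u ** g = g ** u + smat (\<pi> ^ k) X" using X by (simp add: algebra_simps)
  then have "u ** g ** u' ** g' = g ** (u ** u') ** g' + smat (\<pi> ^ k) (X ** u' ** g')"
    by (simp add: matrix_ring_simps)
  then have "u ** g ** u' ** g' = mat 1 + smat (\<pi> ^ k) (X ** u' ** g')"
    using assms(3,4) by (simp add: is_mat_inverse_def)
  moreover have "u ** g ** u' ** g' \<in> D" using assms by (intro commutator_in_derived)
  ultimately have "X ** u' ** g' \<in> level k"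
    by (auto simp: level_def intro!: bexI[of _ "u ** g ** u' ** g'"])
  then show ?thesis using assms(6) level_cong by blast
qed

text \<open>The scalar \<open>c\<close> is central and drops out of the commutator of
  \<open>g\<close> with a lift \<open>u\<close> of a transvection. Knowing \<open>u\<close> modulo
  \<open>\<pi>\<close> is enough because \<open>g\<close> is scalar modulo \<open>\<pi> ^ k\<close>.
  That \<open>g\<close> need only lie in \<open>H\<close> is what starts the induction.\<close>

lemma conj_diff_in_level:
  assumes "k \<ge> 1" "g \<in> H" "r \<noteq> s" "c * c' = 1"
    and g: "mat_cong \<pi> (Suc k) g (smat c (mat 1 + smat (\<pi> ^ k) Y))"
  shows "conj_diff r s a Y \<in> level k"
proof -
  let ?E = "single r s a"
  obtain u where u: "u \<in> H" "mat_cong \<pi> 1 u (mat 1 + ?E)"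
    using det_transvection[OF assms(3)] residual_lift by metis
  obtain u' g' where inv: "is_mat_inverse u u'" "is_mat_inverse g g'"
    using u(1) assms(2) group_inverse by metis
  obtain V where V: "u = mat 1 + ?E + smat \<pi> V" using u(2) by (auto simp: mat_cong_iff)
  obtain W where W: "g = smat c (mat 1 + smat (\<pi> ^ k) Y) + smat (\<pi> ^ Suc k) W"
    using g by (auto simp: mat_cong_iff)
  obtain l where l: "\<pi> ^ k = \<pi> * l" using assms(1) by (cases k) auto
  define X0 where "X0 = smat c (?E ** Y - Y ** ?E)"
  define X1 where "X1 = smat c (V ** Y - Y ** V) + u ** W - W ** u"
  have ug: "u ** g - g ** u = smat (\<pi> ^ k) (X0 + smat \<pi> X1)"
  proof -
    have "u ** g - g ** u = smat (\<pi> ^ k) (smat c (u ** Y - Y ** u) + smat \<pi> (u ** W - W ** u))"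
      by (simp add: W matrix_ring_simps vec_eq_iff algebra_simps)
    moreover have "smat c (u ** Y - Y ** u) = X0 + smat \<pi> (smat c (V ** Y - Y ** V))"
      by (simp add: V X0_def matrix_ring_simps vec_eq_iff algebra_simps)
    ultimately have "u ** g - g ** u = smat (\<pi> ^ k)
        (X0 + smat \<pi> (smat c (V ** Y - Y ** V)) + smat \<pi> (u ** W - W ** u))"
      by (simp only:)
    then show ?thesis
      by (simp only: X1_def smat_add smat_diff add_diff_eq add.assoc[symmetric])
  qed
  have "mat_cong \<pi> 1 g (smat c (mat 1))"
    unfolding mat_cong_iff
    by (rule exI[of _ "smat (c * l) Y + smat (\<pi> ^ k) W"])
      (simp add: W l matrix_ring_simps vec_eq_iff algebra_simps)
  moreover have "smat c (mat 1) ** smat c' (mat 1) = mat 1"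
    using assms(4) by (simp add: mult.commute)
  ultimately have g': "mat_cong \<pi> 1 g' (smat c' (mat 1))"
    using mat_cong_inverse[of \<pi> 1 g] inv(2) unfolding is_mat_inverse_def by blast
  have u': "mat_cong \<pi> 1 u' (transvection r s (- a))"
    using mat_cong_inverse[OF u(2) _ transvection_inverse[OF assms(3)]] inv(1)
    by (simp only: is_mat_inverse_def)
  have "mat_cong \<pi> 1 (X0 + smat \<pi> X1) X0" unfolding mat_cong_iff by auto
  then have "mat_cong \<pi> 1 ((X0 + smat \<pi> X1) ** u' ** g')
      (X0 ** transvection r s (- a) ** smat c' (mat 1))"
    using u' g' by (intro mat_cong_mult)
  \<comment> \<open>As \<open>E^2 = 0\<close>, multiplying \<open>EY - YE\<close> by
    \<open>1 - E\<close> gives \<open>EY - YE - EYE\<close>.\<close>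
  also have "X0 ** transvection r s (- a) ** smat c' (mat 1) =
      smat (c * c') (conj_diff r s a Y)"
    using assms(3) by (auto simp: X0_def vec_eq_iff mult_transvection_nth conj_diff_nth
      single_mult_nth mult_single_nth algebra_simps)
  finally have "mat_cong \<pi> 1 ((X0 + smat \<pi> X1) ** u' ** g') (conj_diff r s a Y)"
    using assms(4) by simp
  then show ?thesis by (rule level_commutator[OF u(1) assms(2) inv ug])
qed

lemma level_stable:
  assumes "k \<ge> 1" shows "transvection_stable_module \<pi> (level k)"
proof unfold_locales
  fix r s :: 'n and X a assume rs: "r \<noteq> s" and "X \<in> level k"
  then obtain g where "g \<in> D" "mat_cong \<pi> (Suc k) g (smat 1 (mat 1 + smat (\<pi> ^ k) X))"
    by (auto simp: level_def)
  then show "conj_diff r s a X \<in> level k"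
    using conj_diff_in_level[OF assms _ rs, of g 1 1] derived_subgroup_subset by simp
qed (use assms level_add level_uminus level_zero level_cong in blast)+

text \<open>An error of order \<open>\<pi> ^ k\<close> enters through brackets with matrices that
  are 1 modulo \<open>\<pi>\<close>, hence only at order \<open>k + 1\<close>. So layers can be
  computed from explicit \<open>G\<close> and \<open>K\<close> that need not belong to
  \<open>H\<close>.\<close>

lemma commutator_in_level:
  assumes k: "k \<ge> 1" and "g \<in> H" "h \<in> H" "mat_cong \<pi> k g G" "mat_cong \<pi> k h K"
    and "mat_cong \<pi> 1 G (mat 1)" "mat_cong \<pi> 1 K (mat 1)"
    and X: "G ** K - K ** G = smat (\<pi> ^ k) X"
  shows "X \<in> level k"
proof -
  obtain g' h' where inv: "is_mat_inverse g g'" "is_mat_inverse h h'"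
    using assms(2,3) group_inverse by metis
  obtain Z W where Z: "g = G + smat (\<pi> ^ k) Z" and W: "h = K + smat (\<pi> ^ k) W"
    using assms(4,5) by (auto simp: mat_cong_iff)
  obtain G' K' where G': "G = mat 1 + smat \<pi> G'" and K': "K = mat 1 + smat \<pi> K'"
    using assms(6,7) by (auto simp: mat_cong_iff)
  obtain l where l: "\<pi> ^ k = \<pi> * l" using k by (cases k) auto
  define X1 where "X1 = G' ** W - W ** G' + Z ** K' - K' ** Z + smat l (Z ** W - W ** Z)"
  have "g ** h - h ** g = (G ** K - K ** G) + smat (\<pi> ^ k)
      (G ** W - W ** G + Z ** K - K ** Z + smat (\<pi> ^ k) (Z ** W - W ** Z))"
    by (simp add: Z W matrix_ring_simps vec_eq_iff algebra_simps)
  also have "G ** W - W ** G + Z ** K - K ** Z + smat (\<pi> ^ k) (Z ** W - W ** Z) = smat \<pi> X1"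
    by (simp add: X1_def l G' K' matrix_ring_simps vec_eq_iff algebra_simps)
  finally have "g ** h - h ** g = smat (\<pi> ^ k) (X + smat \<pi> X1)" by (simp add: X smat_add)
  moreover have "mat_cong \<pi> 1 ((X + smat \<pi> X1) ** g' ** h') (X ** mat 1 ** mat 1)"
  proof (intro mat_cong_mult)
    show "mat_cong \<pi> 1 (X + smat \<pi> X1) X" unfolding mat_cong_iff by auto
    have "mat_cong \<pi> 1 g (mat 1)" "mat_cong \<pi> 1 h (mat 1)"
      using assms(4-7) k mat_cong_mono mat_cong_trans by blast+
    then show "mat_cong \<pi> 1 g' (mat 1)" "mat_cong \<pi> 1 h' (mat 1)"
      using mat_cong_inverse[where B = "mat 1" and B' = "mat 1"] inv matrix_mul_lid
      unfolding is_mat_inverse_def by blast+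
  qed
  ultimately show ?thesis
    using level_commutator[OF assms(2,3) inv] by simp
qed

text \<open>Write \<open>A = h (1 + \<pi>^k X)\<close> with \<open>h\<close> in \<open>D\<close>.
  Comparing determinants to first order makes the trace of \<open>X\<close> divisible by
  \<open>\<pi>\<close>, so an element of layer \<open>k\<close> corrects \<open>h\<close>.\<close>

lemma approximable_Suc:
  assumes k: "k \<ge> 1" and app: "approximable k"
    and level: "\<And>X. \<pi> dvd (\<Sum>i\<in>UNIV. X $ i $ i) \<Longrightarrow> X \<in> level k"
  shows "approximable (Suc k)"
  unfolding approximable_def
proof (intro allI impI)
  fix A :: "'a^'n^'n" assume A: "det A = 1"
  then obtain h where h: "h \<in> D" "mat_cong \<pi> k A h"
    using app mat_cong_sym by (metis approximable_def)
  then obtain h' where h': "h' \<in> D" "is_mat_inverse h h'" using derived_inverse by metis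
  obtain W where W: "A = h + smat (\<pi> ^ k) W" using h(2) by (auto simp: mat_cong_iff)
  define X where "X = h' ** W"
  have hX: "h ** (mat 1 + smat (\<pi> ^ k) X) = A"
    using h'(2) by (simp add: W X_def matrix_add_ldistrib matrix_mul_assoc is_mat_inverse_def)
  then have "det (mat 1 + smat (\<pi> ^ k) X) = 1"
    using A derived_subgroup_det[OF h(1)] by (metis det_mul mult_1)
  then have "(\<pi> ^ k)\<^sup>2 dvd - (\<pi> ^ k * (\<Sum>i\<in>UNIV. X $ i $ i))"
    using det_one_add_cong[of "\<pi> ^ k" X] by simp
  then have "\<pi> ^ k * \<pi> ^ k dvd \<pi> ^ k * (\<Sum>i\<in>UNIV. X $ i $ i)"
    by (simp only: dvd_minus_iff power2_eq_square)
  then have "\<pi> ^ k dvd (\<Sum>i\<in>UNIV. X $ i $ i)"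
    using uniformizer by (simp add: is_uniformizer_def)
  then have "\<pi> dvd (\<Sum>i\<in>UNIV. X $ i $ i)" using k by (metis dvd_power dvd_trans less_le_trans zero_less_one)
  then obtain g where g: "g \<in> D" "mat_cong \<pi> (Suc k) g (mat 1 + smat (\<pi> ^ k) X)"
    using level by (auto simp: level_def)
  have "mat_cong \<pi> (Suc k) (h ** g) (h ** (mat 1 + smat (\<pi> ^ k) X))"
    using g(2) by (intro mat_cong_mult mat_cong_refl)
  then show "\<exists>h\<in>D. mat_cong \<pi> (Suc k) h A"
    using hX derived_mult[OF h(1) g(1)] by metis
qed

subsection \<open>Every layer contains all matrices of trace zero\<close>

text \<open>The given non-scalar element lies in \<open>H\<close> and perhaps not in
  \<open>D\<close>, but its commutators with lifted transvections lie in \<open>D\<close>.\<close>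

lemma trace_zero_in_level_one:
  assumes "H1_has_nonscalar \<pi> H" and tr: "\<pi> dvd (\<Sum>i\<in>UNIV. X $ i $ i)"
  shows "X \<in> level 1"
proof -
  obtain h where h: "h \<in> H" "mat_cong \<pi> 1 h (mat 1)"
    and ns: "\<not> (\<exists>c. mat_cong \<pi> 2 (h - mat 1) (mat c))"
    using assms(1) by (auto simp: H1_has_nonscalar_def)
  obtain Y where Y: "h = mat 1 + smat (\<pi> ^ 1) Y"
    using h(2) by (auto simp: mat_cong_iff)
  interpret transvection_stable_module \<pi> "level 1" by (rule level_stable) simp
  show ?thesis
  proof (rule trace_zero_in_if_nonscalar[OF _ _ tr])
    show "\<not> (\<exists>c. mat_cong \<pi> 1 Y (mat c))"
    proof
      assume "\<exists>c. mat_cong \<pi> 1 Y (mat c)"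
      then obtain c where "mat_cong \<pi> (1 + 1) (smat (\<pi> ^ 1) Y) (smat (\<pi> ^ 1) (mat c))"
        using mat_cong_smat by blast
      moreover have "smat (\<pi> ^ 1) (mat c) = mat (\<pi> * c)" by (simp add: vec_eq_iff mat_nth)
      moreover have "smat (\<pi> ^ 1) Y = h - mat 1" by (simp add: Y)
      ultimately show False using ns by (metis one_add_one)
    qed
    show "conj_diff r s a Y \<in> level 1" if "r \<noteq> s" for r s a
      using conj_diff_in_level[of 1 h r s 1 1 Y a] h(1) that by (simp add: Y)
  qed
qed

lemma approximate_torus:
  assumes "approximable k" "r \<noteq> s" "t * y = 1"
  obtains g where "g \<in> D" "mat_cong \<pi> k g (torus r s t y)"
  using assms det_torus[of r s t y] by (auto simp: approximable_def)

lemma approximate_transvection: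
  assumes "approximable k" "r \<noteq> s"
  obtains g where "g \<in> D" "mat_cong \<pi> k g (transvection r s a)"
  using assms det_transvection[of r s a] by (auto simp: approximable_def)

text \<open>Bracketing \<open>\<pi> E_rs\<close> with \<open>\<pi>^(k-1) E_sr\<close> yields
  \<open>E_rr - E_ss\<close> in layer \<open>k\<close>. This is residually scalar only for two
  indices in residue characteristic two.\<close>

lemma trace_zero_in_level_if_not_exceptional:
  fixes r s :: 'n
  assumes k: "k \<ge> 2" and app: "approximable k" and rs: "r \<noteq> s"
    and exc: "\<not> (UNIV = {r, s} \<and> \<pi> dvd 2)" and tr: "\<pi> dvd (\<Sum>i\<in>UNIV. X $ i $ i)"
  shows "X \<in> level k"
proof -
  obtain m where m: "k = Suc (Suc m)" using le_Suc_ex[OF k] by (auto simp: numeral_eq_Suc)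
  obtain g where g: "g \<in> D" "mat_cong \<pi> k g (transvection r s \<pi>)"
    using approximate_transvection[OF app rs] by blast
  obtain h where h: "h \<in> D" "mat_cong \<pi> k h (transvection s r (\<pi> ^ Suc m))"
    using approximate_transvection[OF app rs[symmetric]] by blast
  interpret transvection_stable_module \<pi> "level k" by (rule level_stable) (use k in simp)
  let ?Y = "single r r 1 - single s s 1"
  have "?Y \<in> level k"
  proof (rule commutator_in_level[OF _ _ _ g(2) h(2)])
    show "transvection r s \<pi> ** transvection s r (\<pi> ^ Suc m) -
        transvection s r (\<pi> ^ Suc m) ** transvection r s \<pi> = smat (\<pi> ^ k) ?Y"
      using rs by (auto simp: vec_eq_iff transvection_mult_nth mat_nth m)
    show "mat_cong \<pi> 1 (transvection r s \<pi>) (mat 1)"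
      "mat_cong \<pi> 1 (transvection s r (\<pi> ^ Suc m)) (mat 1)"
      by (simp_all add: mat_cong_def)
  qed (use k g(1) h(1) derived_subgroup_subset in auto)
  moreover have "\<not> (\<exists>c. mat_cong \<pi> 1 ?Y (mat c))"
  proof
    assume "\<exists>c. mat_cong \<pi> 1 ?Y (mat c)"
    then obtain c where c: "\<pi> dvd ?Y $ i $ j - mat c $ i $ j" for i j
      by (auto simp: mat_cong_def)
    have c1: "\<pi> dvd 1 - c" and c2: "\<pi> dvd - 1 - c"
      using c[of r r] c[of s s] rs by (simp_all add: mat_nth)
    have "\<pi> dvd 2" using dvd_diff[OF c1 c2] by simp
    then obtain t where "t \<noteq> r" "t \<noteq> s" using exc by blast
    then have "\<pi> dvd - c" using c[of t t] by (simp add: mat_nth)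
    then show False using dvd_diff[OF c1, of "- c"] not_dvd_one by simp
  qed
  ultimately show ?thesis
    using trace_zero_in_if_nonscalar[OF _ _ tr] conj_diff_in by blast
qed

text \<open>The first-order bracket of \<open>E_rr - E_ss\<close> with \<open>E_rs\<close> is
  \<open>2 E_rs = 0\<close>. But \<open>1 + \<pi>\<close> and its inverse \<open>v\<close> differ by
  \<open>\<pi>^2 v\<close>, so the diagonal matrix lifts \<open>\<pi>^(k-2) E_rs\<close> to layer
  \<open>k\<close>. For \<open>k >= 3\<close> that transvection is still 1 modulo
  \<open>\<pi>\<close>.\<close>

lemma trace_zero_in_level_if_two_indices:
  fixes r s :: 'n
  assumes k: "k \<ge> 3" and app: "approximable k" and rs: "r \<noteq> s"
    and two: "(2::'a) = 0" and tr: "\<pi> dvd (\<Sum>i\<in>UNIV. X $ i $ i)"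
  shows "X \<in> level k"
proof -
  obtain m where m: "k = Suc (Suc (Suc m))"
    using le_Suc_ex[OF k] by (auto simp: numeral_eq_Suc)
  have "\<not> \<pi> dvd 1 + \<pi>" using not_dvd_one by (simp add: dvd_add_left_iff)
  then obtain v where v: "(1 + \<pi>) * v = 1" by (rule unit_if_not_dvd)
  obtain g where g: "g \<in> D" "mat_cong \<pi> k g (torus r s (1 + \<pi>) v)"
    using approximate_torus[OF app rs v] by blast
  obtain h where h: "h \<in> D" "mat_cong \<pi> k h (transvection r s (\<pi> ^ Suc m))"
    using approximate_transvection[OF app rs] by blast
  interpret transvection_stable_module \<pi> "level k" by (rule level_stable) (use k in simp)
  have v2: "1 + \<pi> - v = \<pi> * \<pi> * v"
  proof -
    have "1 + \<pi> - v = (1 + \<pi>) * ((1 + \<pi>) * v) - v" using v by simp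
    also have "\<dots> = 2 * (\<pi> * v) + \<pi> * \<pi> * v" by (simp add: algebra_simps)
    finally show ?thesis by (simp add: two)
  qed
  have "single r s v \<in> level k"
  proof (rule commutator_in_level[OF _ _ _ g(2) h(2)])
    have "\<pi> ^ Suc m * (1 + \<pi>) - v * \<pi> ^ Suc m = \<pi> ^ Suc m * (1 + \<pi> - v)"
      by (simp add: algebra_simps)
    also have "\<dots> = \<pi> ^ k * v" by (simp add: v2 m mult_ac)
    finally show "torus r s (1 + \<pi>) v ** transvection r s (\<pi> ^ Suc m) -
        transvection r s (\<pi> ^ Suc m) ** torus r s (1 + \<pi>) v = smat (\<pi> ^ k) (single r s v)"
      using rs by (auto simp: vec_eq_iff torus_def diag_mat_mult_nth mult_diag_mat_nth mat_nth
          transvection_mult_nth mult_transvection_nth diag_mat_nth)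
    have "v - 1 = - (\<pi> * v)" using v by (simp add: algebra_simps)
    then have "\<pi> dvd v - 1" by simp
    then show "mat_cong \<pi> 1 (torus r s (1 + \<pi>) v) (mat 1)"
      by (auto simp: mat_cong_def torus_def diag_mat_nth mat_nth)
    show "mat_cong \<pi> 1 (transvection r s (\<pi> ^ Suc m)) (mat 1)"
      by (simp add: mat_cong_def)
  qed (use k g(1) h(1) derived_subgroup_subset in auto)
  moreover have "\<not> (\<exists>c. mat_cong \<pi> 1 (single r s v) (mat c))"
  proof
    assume "\<exists>c. mat_cong \<pi> 1 (single r s v) (mat c)"
    then have "\<pi> dvd v" using rs by (auto simp: mat_cong_def mat_nth split: if_splits)
    then show False using v not_dvd_one by (metis dvd_mult)
  qed
  ultimately show ?thesis
    using trace_zero_in_if_nonscalar[OF _ _ tr] conj_diff_in by blast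
qed

text \<open>For \<open>2 \<times> 2\<close> matrices in characteristic two, the brackets of the first layer with itself are
  scalar, so the second layer has to come from an element \<open>g \<equiv> (1 + \<pi>)(1 + \<pi>\<^sup>2Y)\<close>: it is scalar
  modulo \<open>\<pi>\<^sup>2\<close>, and \<open>det g = 1\<close> forces \<open>tr Y \<equiv> 1\<close>, so that \<open>Y\<close> is not scalar.\<close>
lemma trace_zero_in_level_two:
  fixes r s :: 'n
  assumes app: "approximable 2" and rs: "r \<noteq> s" "UNIV = {r, s}"
    and two: "(2::'a) = 0" and tr: "\<pi> dvd (\<Sum>i\<in>UNIV. X $ i $ i)"
  shows "X \<in> level 2"
proof -
  let ?c = "1 + \<pi>"
  have "\<not> \<pi> dvd ?c" using not_dvd_one by (simp add: dvd_add_left_iff)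
  then obtain v where v: "?c * v = 1" by (rule unit_if_not_dvd)
  have c2: "?c\<^sup>2 = 1 + \<pi>\<^sup>2"
    using two by (simp add: power2_eq_square algebra_simps flip: mult_2)
  \<comment> \<open>So the diagonal matrix is the scalar \<open>?c\<close> modulo
    \<open>\<pi>\<^sup>2\<close>; the deviation at \<open>s\<close> is absorbed into
    \<open>Y\<close>.\<close>
  have v2: "v = ?c - \<pi>\<^sup>2 * v"
  proof -
    have "?c = ?c\<^sup>2 * v" using v by (simp add: power2_eq_square mult.assoc)
    also have "\<dots> = v + \<pi>\<^sup>2 * v" by (simp only: c2 distrib_right mult_1_left)
    finally show ?thesis by (simp only: add_diff_cancel_right')
  qed
  obtain g where g: "g \<in> D" "mat_cong \<pi> 2 g (torus r s ?c v)"
    using approximate_torus[OF app rs(1) v] by blast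
  then obtain W where W: "g = torus r s ?c v + smat (\<pi>\<^sup>2) W" by (auto simp: mat_cong_iff)
  define Y where "Y = smat v (W - single s s v)"
  have gY: "g = smat ?c (mat 1 + smat (\<pi>\<^sup>2) Y)"
  proof -
    have "torus r s ?c v $ i $ j = smat ?c (mat 1) $ i $ j - \<pi>\<^sup>2 * single s s v $ i $ j" for i j
    proof -
      have "i \<in> {r, s}" using rs(2) by blast
      then show ?thesis using rs(1) v2 by (auto simp: torus_def diag_mat_nth mat_nth)
    qed
    then have "torus r s ?c v = smat ?c (mat 1) - smat (\<pi>\<^sup>2) (single s s v)"
      by (simp add: vec_eq_iff)
    moreover have "smat ?c (smat (\<pi>\<^sup>2) Y) = smat (?c * v * \<pi>\<^sup>2) (W - single s s v)"
      by (simp add: Y_def mult_ac)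
    ultimately show ?thesis by (simp add: W v smat_add smat_diff)
  qed
  define t where "t = (\<Sum>i\<in>UNIV. Y $ i $ i)"
  \<comment> \<open>The scalar part has determinant \<open>1 + \<pi>\<^sup>2\<close>. Expanding
    \<open>det g = 1\<close> to first order in \<open>\<pi>\<^sup>2\<close> and cancelling that
    factor leaves the claim.\<close>
  have "\<pi> dvd t + 1"
  proof -
    have "smat ?c (mat 1 :: 'a^'n^'n) = diag_mat (\<lambda>_. ?c)"
      by (simp add: vec_eq_iff mat_nth diag_mat_nth)
    moreover have "CARD('n) = 2" using arg_cong[OF rs(2), of card] rs(1) by simp
    ultimately have "det (smat ?c (mat 1 :: 'a^'n^'n)) = ?c\<^sup>2" by (simp add: det_diag_mat)
    moreover have "g = smat ?c (mat 1) ** (mat 1 + smat (\<pi>\<^sup>2) Y)" by (simp add: gY)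
    ultimately have "1 = (1 + \<pi>\<^sup>2) * det (mat 1 + smat (\<pi>\<^sup>2) Y)"
      using derived_subgroup_det[OF g(1)] c2 by (metis det_mul)
    moreover obtain q where "det (mat 1 + smat (\<pi>\<^sup>2) Y) - 1 - \<pi>\<^sup>2 * t = (\<pi>\<^sup>2)\<^sup>2 * q"
      using det_one_add_cong[of "\<pi>\<^sup>2" Y] by (auto simp: t_def dvd_def)
    then have "det (mat 1 + smat (\<pi>\<^sup>2) Y) = 1 + \<pi>\<^sup>2 * t + (\<pi>\<^sup>2)\<^sup>2 * q"
      by (simp add: algebra_simps)
    ultimately have "1 = (1 + \<pi>\<^sup>2) * (1 + \<pi>\<^sup>2 * t + (\<pi>\<^sup>2)\<^sup>2 * q)" by simp
    then have "\<pi>\<^sup>2 * (t + 1 + \<pi> * (\<pi> * (t + q + \<pi>\<^sup>2 * q))) = 0"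
      by (simp add: algebra_simps power2_eq_square)
    then have "t + 1 + \<pi> * (\<pi> * (t + q + \<pi>\<^sup>2 * q)) = 0"
      using uniformizer by (simp add: is_uniformizer_def)
    then have "t + 1 = \<pi> * (- (\<pi> * (t + q + \<pi>\<^sup>2 * q)))"
      by (simp add: eq_neg_iff_add_eq_0)
    then show ?thesis by (rule dvdI)
  qed
  interpret transvection_stable_module \<pi> "level 2" by (rule level_stable) simp
  show ?thesis
  proof (rule trace_zero_in_if_nonscalar[OF _ _ tr])
    show "\<not> (\<exists>c. mat_cong \<pi> 1 Y (mat c))"
    proof
      assume "\<exists>c. mat_cong \<pi> 1 Y (mat c)"
      then obtain c where c: "\<pi> dvd Y $ i $ j - mat c $ i $ j" for i j
        by (auto simp: mat_cong_def)
      have "\<pi> dvd (Y $ r $ r - c) + (Y $ s $ s - c)"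
        using c[of r r] c[of s s] by (intro dvd_add) (simp_all add: mat_nth)
      moreover have "t = Y $ r $ r + Y $ s $ s"
        unfolding t_def rs(2) using rs(1) by simp
      ultimately have "\<pi> dvd t - 2 * c" by (simp add: algebra_simps)
      then have "\<pi> dvd t" by (simp add: two)
      then show False using \<open>\<pi> dvd t + 1\<close> not_dvd_one by (simp add: dvd_add_right_iff)
    qed
    show "conj_diff r s a Y \<in> level 2" if "r \<noteq> s" for r s a
      using conj_diff_in_level[of 2 g r s ?c v Y a] that v derived_subgroup_subset[OF g(1)]
      by (simp add: gY)
  qed
qed

lemma approximable:
  assumes "H1_has_nonscalar \<pi> H" "CARD('n) \<ge> 2" and two: "\<pi> dvd 2 \<Longrightarrow> (2::'a) = 0"
  shows "approximable m"
proof -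
  obtain r s :: 'n where rs: "r \<noteq> s"
    using assms(2) card_le_Suc0_iff_eq[of "UNIV :: 'n set"] by auto
  have "approximable (Suc k)" for k
  proof (induction k)
    case 0
    then show ?case using approximable_one by simp
  next
    case (Suc k)
    show ?case
    proof (rule approximable_Suc[OF _ Suc.IH])
      fix X :: "'a^'n^'n" assume tr: "\<pi> dvd (\<Sum>i\<in>UNIV. X $ i $ i)"
      \<comment> \<open>The layer in question is \<open>Suc k\<close>, so \<open>k = 0\<close>,
        \<open>k = 1\<close> and \<open>k >= 2\<close> mean layers 1, 2 and at least 3.\<close>
      consider "k = 0" | "k \<ge> 1" "\<not> (UNIV = {r, s} \<and> \<pi> dvd 2)"
        | "k = 1" "UNIV = {r, s}" "\<pi> dvd 2" | "k \<ge> 2" "UNIV = {r, s}" "\<pi> dvd 2"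
        by linarith
      then show "X \<in> level (Suc k)"
      proof cases
        case 1
        then show ?thesis using trace_zero_in_level_one[OF assms(1) tr] by simp
      next
        case 2
        then show ?thesis
          using trace_zero_in_level_if_not_exceptional[OF _ Suc.IH rs _ tr] by simp
      next
        case 3
        then have "Suc k = 2" by simp
        then show ?thesis
          using trace_zero_in_level_two[OF _ rs 3(2) two[OF 3(3)] tr] Suc.IH by (simp only:)
      next
        case 4
        then show ?thesis
          using trace_zero_in_level_if_two_indices[OF _ Suc.IH rs two[OF 4(3)] tr] 4(1) by simp
      qed
    qed simp
  qed
  then have "approximable (Suc m)" .
  \<comment> \<open>The induction covers positive exponents; passing from \<open>Suc m\<close> down
    to \<open>m\<close> includes exponent 0.\<close>
  then show ?thesis unfolding approximable_def using mat_cong_mono by (metis le_SucI order_refl)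
qed

end

theorem mainTheorem14:
  fixes \<pi> :: "'a::idom" and H :: "('a^'n::finite^'n) set"
  assumes "dvr_with_uniformizer \<pi>"
    and "adic_complete \<pi>"
    and "equal_char \<pi>"
    and "finite (residue_field \<pi>)" and "card (residue_field \<pi>) > 9"
    and "CARD('n) \<ge> 2"
    and "is_subgroup_GL H" and "adic_closed \<pi> H"
    and "SLk_in_H0 \<pi> H"
    and "H1_has_nonscalar \<pi> H"
  shows "Hder \<pi> H = SL"
proof -
  interpret residually_full_group \<pi> H
    using assms by unfold_locales (auto simp: dvr_with_uniformizer_def)
  \<comment> \<open>Equal characteristic turns residue characteristic two into characteristic two of
    the ring itself.\<close>
  have "(2::'a) = 0" if "\<pi> dvd 2"
    using assms(3) that by (metis equal_char_def of_nat_numeral)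
  then have app: "approximable m" for m
    using approximable assms(6,10) by blast
  show ?thesis
  proof
    show "Hder \<pi> H \<subseteq> SL"
    proof
      fix A assume A: "A \<in> Hder \<pi> H"
      \<comment> \<open>Every approximant of \<open>A\<close> lies in \<open>D\<close> and has
        determinant 1.\<close>
      have "\<pi> ^ m dvd det A - 1" for m
        using A mat_cong_det derived_subgroup_det by (fastforce simp: Hder_def adic_closure_def)
      then have "det A - 1 = 0" by (rule eq_0_if_dvd_powers)
      then show "A \<in> SL" by (simp add: SL_def)
    qed
    show "SL \<subseteq> Hder \<pi> H"
      using app mat_cong_sym by (auto simp: Hder_def adic_closure_def SL_def approximable_def) blast
  qed
qed

end
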